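(* Let $\alpha>0$. There is a constant $C>0$ such that for all $x\in\mathbb{Q}_S$ and $t>0$, $$Z(x,t)\le C\,t\,\bigl(t^{1/\alpha}+\|x\|\bigr)^{-\alpha-1}.$$
   Context: Let $S$ be a nonempty finite set of prime numbers, $\mathbb{Q}_S=\prod_{p\in S}\mathbb{Q}_p$ with the product topology and componentwise operations, and $\mathbb{Z}_S=\prod_{p\in S}\mathbb{Z}_p$; $\mathbb{Q}$ is embedded diagonally in $\mathbb{Q}_S$. Let $dx$ be the Haar measure on $(\mathbb{Q}_S,+)$ with $\mathbb{Z}_S$ of measure $1$. Let $q_1<q_2<\cdots$ be the increasing enumeration of $\{p^l: p\in S,\ l\ge 1\}$ and let $p_k\in S$ be the prime of which $q_k$ is a power. Define $\psi:\mathbb{Z}\to\mathbb{R}$ by $\psi(0)=0$, $\psi(n)=\sum_{k=1}^n\log p_k$ and $\psi(-n)=-\psi(n)$ for $n\ge1$; thus $e^{\psi(n)}\in\mathbb{Q}$ and $\psi$ is strictly increasing. Put $B_n=e^{-\psi(n)}\mathbb{Z}_S$ for $n\in\mathbb{Z}$. These are compact open subgroups with $B_{n-1}\subsetneq B_n$, $\bigcap_n B_n=\{0\}$, $\bigcup_n B_n=\mathbb{Q}_S$, and $B_n$ has Haar measure $e^{\psi(n)}$. Define $\|0\|=0$ and $\|x\|=e^{\psi(n)}$ if $x\in B_n\setminus B_{n-1}$. Let $\chi(x)=\prod_{p\in S}\exp(2\pi i\{x_p\}_p)$ for $x=(x_p)_{p\in S}$, where $\{\cdot\}_p$ is the $p$-adic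 fractional part. For $\alpha>0$ the heat kernel is $Z(x,t)=\int_{\mathbb{Q}_S}\chi(-x\xi)\exp(-t\|\xi\|^\alpha)\,d\xi$ for $x\in\mathbb{Q}_S$, $t>0$. The constant $C$ may depend on $S$ and $\alpha$. *)

theory Defs
  imports "HOL-Analysis.Analysis" "HOL-Algebra.QuotRing" "HOL-Computational_Algebra.Primes"
begin

text \<open>
  The field of \<open>p\<close>-adic numbers is the completion of the rationals with respect to the
  \<open>p\<close>-adic absolute value: the ring of \<open>p\<close>-adic Cauchy sequences of rationals modulo the ideal of
  null sequences.  Since the prime is an argument and not part of the type, every
  \<open>p\<close>-adic field is a ring with carrier in the fixed type \<^typ>\<open>(nat \<Rightarrow> rat) set\<close>.
\<close>

definition padic_abs :: "nat \<Rightarrow> rat \<Rightarrow> real" where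
  "padic_abs p r = (if r = 0 then 0 else
     real p powi (int (multiplicity (int p) (snd (quotient_of r))) -
                  int (multiplicity (int p) (fst (quotient_of r)))))"

definition padic_Cauchy :: "nat \<Rightarrow> (nat \<Rightarrow> rat) ring" where
  "padic_Cauchy p =
     \<lparr>carrier = {x. \<forall>e>0. \<exists>N. \<forall>m\<ge>N. \<forall>n\<ge>N. padic_abs p (x m - x n) < e},
      mult = (\<lambda>x y n. x n * y n),
      one = (\<lambda>n. 1),
      zero = (\<lambda>n. 0),
      add = (\<lambda>x y n. x n + y n)\<rparr>"

definition padic_null :: "nat \<Rightarrow> (nat \<Rightarrow> rat) set" where
  "padic_null p = {x. (\<lambda>n. padic_abs p (x n)) \<longlonglongrightarrow> 0}"

definition Qp :: "nat \<Rightarrow> ((nat \<Rightarrow> rat) set) ring" where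
  "Qp p = padic_Cauchy p Quot padic_null p"

definition Qp_of_rat :: "nat \<Rightarrow> rat \<Rightarrow> (nat \<Rightarrow> rat) set" where
  "Qp_of_rat p r = padic_null p +>\<^bsub>padic_Cauchy p\<^esub> (\<lambda>n. r)"

text \<open>The continuous extension of the absolute value; the limit does not depend on the representative.\<close>

definition Qp_abs :: "nat \<Rightarrow> (nat \<Rightarrow> rat) set \<Rightarrow> real" where
  "Qp_abs p X = (THE r. \<forall>x\<in>X. (\<lambda>n. padic_abs p (x n)) \<longlonglongrightarrow> r)"

definition Qp_topology :: "nat \<Rightarrow> ((nat \<Rightarrow> rat) set) topology" where
  "Qp_topology p =
     Metric_space.mtopology (carrier (Qp p)) (\<lambda>X Y. Qp_abs p (X \<ominus>\<^bsub>Qp p\<^esub> Y))"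

definition Zp :: "nat \<Rightarrow> ((nat \<Rightarrow> rat) set) set" where
  "Zp p = {X \<in> carrier (Qp p). Qp_abs p X \<le> 1}"

text \<open>The \<open>p\<close>-adic fractional part: the unique \<open>r \<in> \<int>[1/p] \<inter> [0,1)\<close> with \<open>X - r \<in> \<int>\<^sub>p\<close>.\<close>

definition Qp_frac :: "nat \<Rightarrow> (nat \<Rightarrow> rat) set \<Rightarrow> rat" where
  "Qp_frac p X = (THE r. 0 \<le> r \<and> r < 1 \<and> (\<exists>(a::int) (k::nat). r = of_int a / of_nat p ^ k) \<and>
                         X \<ominus>\<^bsub>Qp p\<^esub> Qp_of_rat p r \<in> Zp p)"

type_synonym qs = "nat \<Rightarrow> (nat \<Rightarrow> rat) set"

definition QS :: "nat set \<Rightarrow> qs ring" where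
  "QS S =
     \<lparr>carrier = (\<Pi>\<^sub>E p\<in>S. carrier (Qp p)),
      mult = (\<lambda>x y. \<lambda>p\<in>S. x p \<otimes>\<^bsub>Qp p\<^esub> y p),
      one = (\<lambda>p\<in>S. \<one>\<^bsub>Qp p\<^esub>),
      zero = (\<lambda>p\<in>S. \<zero>\<^bsub>Qp p\<^esub>),
      add = (\<lambda>x y. \<lambda>p\<in>S. x p \<oplus>\<^bsub>Qp p\<^esub> y p)\<rparr>"

definition QS_topology :: "nat set \<Rightarrow> qs topology" where
  "QS_topology S = product_topology Qp_topology S"

definition ZS :: "nat set \<Rightarrow> qs set" where
  "ZS S = (\<Pi>\<^sub>E p\<in>S. Zp p)"

definition QS_of_rat :: "nat set \<Rightarrow> rat \<Rightarrow> qs" where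
  "QS_of_rat S r = (\<lambda>p\<in>S. Qp_of_rat p r)"

text \<open>
  Normalised Haar measure on the additive group.  For finite \<open>S\<close> the space is second countable and
  locally compact, so a Borel measure that is finite on compact sets is automatically regular.
\<close>

definition QS_haar :: "nat set \<Rightarrow> qs measure \<Rightarrow> bool" where
  "QS_haar S \<mu> \<longleftrightarrow>
     space \<mu> = carrier (QS S) \<and>
     sets \<mu> = sigma_sets (carrier (QS S)) {U. openin (QS_topology S) U} \<and>
     (\<forall>a\<in>carrier (QS S). \<forall>A\<in>sets \<mu>. emeasure \<mu> ((\<lambda>x. a \<oplus>\<^bsub>QS S\<^esub> x) ` A) = emeasure \<mu> A) \<and>
     (\<forall>K. compactin (QS_topology S) K \<longrightarrow> emeasure \<mu> K < \<infinity>) \<and>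
     emeasure \<mu> (ZS S) = 1"

text \<open>\<open>enumerate\<close> counts from \<open>0\<close>, the sequence \<open>q\<close> from \<open>1\<close>; only \<open>k \<ge> 1\<close> is used below.\<close>

definition q_seq :: "nat set \<Rightarrow> nat \<Rightarrow> nat" where
  "q_seq S k = enumerate {p ^ l | p l. p \<in> S \<and> l \<ge> 1} (k - 1)"

definition p_seq :: "nat set \<Rightarrow> nat \<Rightarrow> nat" where
  "p_seq S k = (THE p. p \<in> S \<and> (\<exists>l\<ge>1. q_seq S k = p ^ l))"

definition psi :: "nat set \<Rightarrow> int \<Rightarrow> real" where
  "psi S n = (if n \<ge> 0 then (\<Sum>k=1..nat n. ln (real (p_seq S k)))
              else - (\<Sum>k=1..nat (- n). ln (real (p_seq S k))))"

text \<open>\<open>exp_psi S n\<close> is the number \<open>exp (psi S n)\<close>, which is rational, as an element of \<^typ>\<open>rat\<close>.\<close>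

definition exp_psi :: "nat set \<Rightarrow> int \<Rightarrow> rat" where
  "exp_psi S n = (THE r. real_of_rat r = exp (psi S n))"

definition QS_B :: "nat set \<Rightarrow> int \<Rightarrow> qs set" where
  "QS_B S n = (\<lambda>z. QS_of_rat S (inverse (exp_psi S n)) \<otimes>\<^bsub>QS S\<^esub> z) ` ZS S"

definition QS_norm :: "nat set \<Rightarrow> qs \<Rightarrow> real" where
  "QS_norm S x = (if x = \<zero>\<^bsub>QS S\<^esub> then 0
                  else exp (psi S (THE n. x \<in> QS_B S n - QS_B S (n - 1))))"

definition QS_char :: "nat set \<Rightarrow> qs \<Rightarrow> complex" where
  "QS_char S x = (\<Prod>p\<in>S. exp (2 * complex_of_real pi * \<i> * of_rat (Qp_frac p (x p))))"

definition heat_kernel :: "nat set \<Rightarrow> qs measure \<Rightarrow> real \<Rightarrow> qs \<Rightarrow> real \<Rightarrow> complex" where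
  "heat_kernel S \<mu> \<alpha> x t =
     (LINT \<xi>|\<mu>. QS_char S (\<ominus>\<^bsub>QS S\<^esub> (x \<otimes>\<^bsub>QS S\<^esub> \<xi>)) *
                complex_of_real (exp (- t * QS_norm S \<xi> powr \<alpha>)))"

end

theory Submission
  imports Defs "HOL-Number_Theory.Cong"
begin

text \<open>
  Write \<open>r\<^sub>n = exp (psi S n)\<close> for the measure of the ball \<open>B\<^sub>n\<close>, \<open>g \<xi> = exp (- t \<parallel>\<xi>\<parallel>\<^sup>\<alpha>)\<close> and
  \<open>\<chi>\<^sub>x \<xi> = \<chi> (- x \<xi>)\<close>, so that \<open>Z(x,t)\<close> is the integral of \<open>\<chi>\<^sub>x g\<close>.  Two bounds are proved, one
  good for small and one good for large \<open>\<parallel>x\<parallel>\<close>; the smaller of the two is comparable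
  with the right-hand side (\<open>min_bound_combined\<close>).

  Since \<open>\<bar>\<chi>\<^sub>x\<bar> = 1\<close>, the kernel is at most the integral of \<open>g\<close>.  Put \<open>u = t powr (- 1 / \<alpha>)\<close>.
  The radii at least double from one ball to the next, so beyond the largest radius not exceeding
  \<open>u\<close> the contributions of the shells to this integral decay geometrically, and the integral is
  at most a constant times \<open>u\<close> (\<open>integral_weight_le\<close>).

  For \<open>\<parallel>x\<parallel> = r\<^sub>m > 0\<close> there is cancellation (\<open>heat_kernel_nonzero\<close>).  The annihilator of
  \<open>B\<^sub>n\<close> is \<open>B\<^sub>-\<^sub>n\<close>; as \<open>x\<close> lies in \<open>B\<^sub>m\<close> but not in \<open>B\<^sub>m\<^sub>-\<^sub>1\<close>, the character \<open>\<chi>\<^sub>x\<close> is trivial on the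
  ball \<open>D = B\<^sub>-\<^sub>m\<close>, but not on the next larger one \<open>A = B\<^sub>1\<^sub>-\<^sub>m\<close>.  Choose \<open>y\<close> in \<open>A\<close> with
  \<open>\<chi>\<^sub>x y \<noteq> 1\<close>.  By the ultrametric inequality translation by \<open>y\<close> preserves \<open>A\<close> and does not change
  the norm outside \<open>A\<close>, so it multiplies both \<open>\<chi>\<^sub>x 1\<^sub>A\<close> and \<open>\<chi>\<^sub>x g\<close> restricted to the complement of \<open>A\<close>
  by \<open>\<chi>\<^sub>x y\<close>; hence both have integral zero.  On the shell between \<open>D\<close> and \<open>A\<close> the function \<open>g\<close> has
  a constant value \<open>c\<close>, and therefore \<open>Z(x,t)\<close> is the integral of \<open>g - c\<close> over \<open>D\<close>.  This is real,
  and \<open>g - c \<le> 1 - c \<le> t r\<^sup>\<alpha>\<close> with \<open>r\<close> the radius of \<open>A\<close>.  The radius of \<open>A\<close> is at most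
  \<open>Max S\<close> times that of \<open>D\<close>, which is \<open>1 / \<parallel>x\<parallel>\<close>; this gives the second bound
  (\<open>heat_kernel_off_diagonal\<close>).

  What these arguments need from the arithmetic is: each \<open>B\<^sub>n\<close> is a product of \<open>p\<close>-adic balls
  and consists of \<open>p\<close> cosets of \<open>B\<^sub>n\<^sub>-\<^sub>1\<close> for some \<open>p\<close> in \<open>S\<close>
  (\<open>scaled_ZS_eq_ball\<close>, \<open>ball_divide_cosets\<close>), the balls exhaust the space and shrink to zero
  (\<open>shell_exists\<close>), and the character is additive, trivial on \<open>ZS S\<close> and detects
  elements outside a given ball (\<open>QS_char_detects\<close>).
\<close>

section \<open>The \<open>p\<close>-adic absolute value on the rationals\<close>

locale padic =
  fixes p :: nat
  assumes prime_p: "prime p"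
begin

abbreviation pabs :: "rat \<Rightarrow> real" where "pabs \<equiv> padic_abs p"
abbreviation mul :: "int \<Rightarrow> nat" where "mul \<equiv> multiplicity (int p)"

lemma p_pos [simp]: "0 < p" and p_real_gt_1: "1 < real p"
  using prime_gt_1_nat[OF prime_p] by auto

lemma prime_int_p: "prime (int p)"
  using prime_p by simp

lemma pabs_0 [simp]: "pabs 0 = 0"
  by (simp add: padic_abs_def)

lemma pabs_pos: "r \<noteq> 0 \<Longrightarrow> 0 < pabs r"
  by (simp add: padic_abs_def)

lemma pabs_nonneg [simp]: "0 \<le> pabs r"
  by (simp add: padic_abs_def)

lemma pabs_eq_0_iff [simp]: "pabs r = 0 \<longleftrightarrow> r = 0"
  using pabs_pos[of r] by (cases "r = 0") auto

lemma mul_mult: "a \<noteq> 0 \<Longrightarrow> b \<noteq> 0 \<Longrightarrow> mul (a * b) = mul a + mul b"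
  using prime_int_p by (intro prime_elem_multiplicity_mult_distrib) auto

text \<open>The definition reads off numerator and denominator in lowest terms; this form for an arbitrary
  fraction is what makes multiplicativity immediate.\<close>

lemma pabs_fraction:
  assumes "u \<noteq> 0" "v \<noteq> 0"
  shows "pabs (of_int u / of_int v) = real p powi (int (mul v) - int (mul u))"
proof -
  obtain a b where ab: "quotient_of (of_int u / of_int v) = (a, b)"
    by fastforce
  have b: "b > 0" using quotient_of_denom_pos[OF ab] .
  have eq: "(of_int u / of_int v :: rat) = of_int a / of_int b"
    using quotient_of_div[OF ab] .
  hence a: "a \<noteq> 0" using assms b by auto
  have "(of_int (u * b) :: rat) = of_int (a * v)"
    using eq assms b by (simp add: field_simps)
  hence "u * b = a * v" by (simp only: of_int_eq_iff)
  hence "mul u + mul b = mul a + mul v"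
    using mul_mult[of u b] mul_mult[of a v] assms a b by simp
  hence "int (mul b) - int (mul a) = int (mul v) - int (mul u)" by linarith
  thus ?thesis
    using assms ab by (simp add: padic_abs_def)
qed

lemma pabs_of_int: "u \<noteq> 0 \<Longrightarrow> pabs (of_int u) = 1 / real p ^ mul u"
  using pabs_fraction[of u 1] by (simp add: power_int_minus divide_inverse)

lemma pabs_1 [simp]: "pabs 1 = 1"
  using pabs_of_int[of 1] by simp

lemma pabs_mult: "pabs (r * s) = pabs r * pabs s"
proof (cases "r = 0 \<or> s = 0")
  case False
  obtain a b where r: "r = of_int a / of_int b" "b > 0"
    using quotient_of_div quotient_of_denom_pos by (metis surj_pair)
  obtain c d where s: "s = of_int c / of_int d" "d > 0"
    using quotient_of_div quotient_of_denom_pos by (metis surj_pair)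
  have nz: "a \<noteq> 0" "c \<noteq> 0" using False r s by auto
  have "r * s = of_int (a * c) / of_int (b * d)" using r s by simp
  hence "pabs (r * s) = real p powi (int (mul (b * d)) - int (mul (a * c)))"
    using pabs_fraction[of "a * c" "b * d"] nz r s by simp
  also have "\<dots> = real p powi ((int (mul b) - int (mul a)) + (int (mul d) - int (mul c)))"
    using mul_mult nz r s by (simp add: algebra_simps)
  also have "\<dots> = pabs r * pabs s"
    using pabs_fraction[of a b] pabs_fraction[of c d] nz r s by (simp add: power_int_add)
  finally show ?thesis .
qed auto

lemma pabs_inverse: "pabs (inverse r) = inverse (pabs r)"
  using pabs_mult[of r "inverse r"] by (cases "r = 0") (auto simp: field_simps)

lemma pabs_divide: "pabs (r / s) = pabs r / pabs s"
  by (simp add: divide_inverse pabs_mult pabs_inverse)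

lemma pabs_power: "pabs (r ^ k) = pabs r ^ k"
  by (induction k) (auto simp: pabs_mult)

lemma pabs_minus [simp]: "pabs (- r) = pabs r"
proof -
  have "(pabs (-1))\<^sup>2 = 1" using pabs_mult[of "-1" "-1"] by (simp add: power2_eq_square)
  hence "pabs (-1) = 1" using pabs_nonneg[of "-1"] by (simp add: power2_eq_1_iff)
  thus ?thesis using pabs_mult[of "-1" r] by simp
qed

lemma pabs_minus_commute: "pabs (r - s) = pabs (s - r)"
  using pabs_minus[of "r - s"] by simp

lemma pabs_of_int_le_iff: "pabs (of_int u) \<le> 1 / real p ^ k \<longleftrightarrow> int p ^ k dvd u"
proof (cases "u = 0")
  case False
  have "int p ^ k dvd u \<longleftrightarrow> k \<le> mul u"
    using False prime_int_p by (intro power_dvd_iff_le_multiplicity) auto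
  moreover have "1 / real p ^ mul u \<le> 1 / real p ^ k \<longleftrightarrow> k \<le> mul u"
    using p_real_gt_1 by (simp add: field_simps)
  ultimately show ?thesis using pabs_of_int[OF False] by simp
qed auto

lemma pabs_of_int_le_1: "pabs (of_int u) \<le> 1"
  using pabs_of_int_le_iff[of u 0] by simp

lemma pabs_p: "pabs (of_nat p) = 1 / real p"
  using pabs_of_int[of "int p"] prime_int_p
  by (simp add: multiplicity_self)

lemma pabs_other_prime: "prime q \<Longrightarrow> q \<noteq> p \<Longrightarrow> pabs (of_nat q) = 1"
  using pabs_of_int[of "int q"] prime_p
  by (simp add: prime_multiplicity_other prime_gt_0_nat)

lemma pabs_add: "pabs (r + s) \<le> max (pabs r) (pabs s)"
proof -
  have int_case: "pabs (of_int (a + b)) \<le> max (pabs (of_int a)) (pabs (of_int b))" for a b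
  proof (cases "a = 0 \<or> b = 0")
    case False
    define k where "k = min (mul a) (mul b)"
    have "int p ^ k dvd a" "int p ^ k dvd b"
      by (auto simp: k_def intro!: multiplicity_dvd')
    hence "pabs (of_int (a + b)) \<le> 1 / real p ^ k"
      unfolding pabs_of_int_le_iff by (rule dvd_add)
    also have "\<dots> \<le> max (pabs (of_int a)) (pabs (of_int b))"
      using False by (auto simp: k_def pabs_of_int min_def)
    finally show ?thesis .
  qed auto
  obtain a b where r: "r = of_int a / of_int b" "b > 0"
    using quotient_of_div quotient_of_denom_pos by (metis surj_pair)
  obtain c d where s: "s = of_int c / of_int d" "d > 0"
    using quotient_of_div quotient_of_denom_pos by (metis surj_pair)
  define w where "w = (of_int (b * d) :: rat)"
  have w: "w \<noteq> 0" using r s by (simp add: w_def)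
  have eqs: "r = of_int (a * d) / w" "s = of_int (c * b) / w"
    using r s by (simp_all add: w_def)
  have "r + s = of_int (a * d + c * b) / w"
    by (simp add: eqs add_divide_distrib)
  hence "pabs (r + s) = pabs (of_int (a * d + c * b)) / pabs w"
    by (simp only: pabs_divide)
  also have "\<dots> \<le> max (pabs (of_int (a * d))) (pabs (of_int (c * b))) / pabs w"
    by (intro divide_right_mono int_case) simp
  also have "\<dots> = max (pabs r) (pabs s)"
    using pabs_pos[OF w] by (simp only: eqs pabs_divide) (simp add: max_def divide_le_cancel)
  finally show ?thesis .
qed

lemma pabs_diff: "pabs (r - s) \<le> max (pabs r) (pabs s)"
  using pabs_add[of r "- s"] by simp

lemma pabs_abs_diff: "\<bar>pabs r - pabs s\<bar> \<le> pabs (r - s)"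
proof -
  have "pabs r \<le> pabs (r - s) + pabs s"
    using pabs_add[of "r - s" s] pabs_nonneg[of s] pabs_nonneg[of "r - s"]
    by (simp only: diff_add_cancel)
  moreover have "pabs s \<le> pabs (r - s) + pabs r"
    using pabs_add[of "s - r" r] pabs_nonneg[of r] pabs_nonneg[of "r - s"] 
      pabs_minus_commute[of r s] by (simp only: diff_add_cancel)
  ultimately show ?thesis by linarith
qed

text \<open>The integers are dense in \<open>\<int>\<^sub>p \<inter> \<rat>\<close>: the denominator of \<open>r\<close> is prime to \<open>p\<close>, so it is invertible
  modulo \<open>p ^ k\<close>.\<close>

lemma int_approximation:
  assumes "pabs r \<le> 1"
  shows "\<exists>b. pabs (r - of_int b) \<le> 1 / real p ^ k"
proof -
  obtain u v where uv: "quotient_of r = (u, v)" by fastforce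
  have r: "r = of_int u / of_int v" and v: "v > 0" and cop: "coprime u v"
    using quotient_of_div[OF uv] quotient_of_denom_pos[OF uv] quotient_of_coprime[OF uv] by auto
  have ndvd: "\<not> int p dvd v"
  proof
    assume dv: "int p dvd v"
    have "pabs (of_int v) \<le> 1 / real p"
      using pabs_of_int_le_iff[of v 1] dv by simp
    moreover have "pabs (of_int u) \<le> pabs (of_int v)"
      using assms v pabs_pos[of "of_int v"] by (simp add: r pabs_divide field_simps)
    ultimately have "int p dvd u" using pabs_of_int_le_iff[of u 1] by simp
    with dv cop have "is_unit (int p)" by (meson coprime_common_divisor)
    thus False using prime_int_p by (simp add: prime_gt_1_nat)
  qed
  hence "coprime v (int p ^ k)"
    using prime_int_p by (metis coprime_commute coprime_power_right_iff prime_imp_coprime)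
  then obtain b0 where "[v * b0 = 1] (mod (int p ^ k))"
    using cong_solve_coprime_int by blast
  hence "[v * b0 * u = 1 * u] (mod (int p ^ k))"
    by (rule cong_scalar_right)
  hence dvd: "int p ^ k dvd u - v * (b0 * u)"
    by (metis cong_iff_dvd_diff cong_sym mult.assoc mult_1)
  have "pabs (of_int v) = 1"
    using pabs_of_int[of v] v ndvd by (simp add: not_dvd_imp_multiplicity_0)
  moreover have "r - of_int (b0 * u) = of_int (u - v * (b0 * u)) / of_int v"
    using v by (simp add: r field_simps)
  ultimately have "pabs (r - of_int (b0 * u)) = pabs (of_int (u - v * (b0 * u)))"
    by (simp only: pabs_divide)
  also have "\<dots> \<le> 1 / real p ^ k" using dvd pabs_of_int_le_iff by blast
  finally show ?thesis by blast
qed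

lemma p_fraction_integral:
  assumes "r = of_int a / of_nat p ^ k" "pabs r \<le> 1"
  shows "r \<in> \<int>"
proof -
  have "pabs (of_int a) \<le> 1 / real p ^ k"
    using assms(2) p_real_gt_1 by (simp add: assms(1) pabs_divide pabs_power pabs_p field_simps)
  then obtain c where "a = int p ^ k * c"
    using pabs_of_int_le_iff by (auto elim: dvdE)
  hence "r = of_int c" using p_pos by (simp add: assms(1))
  thus ?thesis by simp
qed

end

section \<open>The field of \<open>p\<close>-adic numbers\<close>

context padic
begin

lemma Cauchy_carrier_iff:
  "x \<in> carrier (padic_Cauchy p) \<longleftrightarrow> (\<forall>e>0. \<exists>N. \<forall>m\<ge>N. \<forall>n\<ge>N. pabs (x m - x n) < e)"
  by (simp add: padic_Cauchy_def)

lemma Cauchy_simps [simp]: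
  "mult (padic_Cauchy p) = (\<lambda>x y n. x n * y n)"
  "one (padic_Cauchy p) = (\<lambda>n. 1)"
  "zero (padic_Cauchy p) = (\<lambda>n. 0)"
  "add (padic_Cauchy p) = (\<lambda>x y n. x n + y n)"
  by (simp_all add: padic_Cauchy_def)

lemma Cauchy_const [simp]: "(\<lambda>n. r) \<in> carrier (padic_Cauchy p)"
  by (simp add: Cauchy_carrier_iff)

lemma Cauchy_uminus:
  "x \<in> carrier (padic_Cauchy p) \<Longrightarrow> (\<lambda>n. - x n) \<in> carrier (padic_Cauchy p)"
  unfolding Cauchy_carrier_iff using pabs_minus_commute by simp

lemma Cauchy_plus:
  assumes "x \<in> carrier (padic_Cauchy p)" "y \<in> carrier (padic_Cauchy p)"
  shows "(\<lambda>n. x n + y n) \<in> carrier (padic_Cauchy p)"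
  unfolding Cauchy_carrier_iff
proof (intro allI impI)
  fix e :: real assume e: "e > 0"
  obtain N1 where N1: "\<And>m n. m \<ge> N1 \<Longrightarrow> n \<ge> N1 \<Longrightarrow> pabs (x m - x n) < e"
    using assms(1) e unfolding Cauchy_carrier_iff by meson
  obtain N2 where N2: "\<And>m n. m \<ge> N2 \<Longrightarrow> n \<ge> N2 \<Longrightarrow> pabs (y m - y n) < e"
    using assms(2) e unfolding Cauchy_carrier_iff by meson
  have "pabs ((x m + y m) - (x n + y n)) < e" if "m \<ge> max N1 N2" "n \<ge> max N1 N2" for m n
    using pabs_add[of "x m - x n" "y m - y n"] N1[of m n] N2[of m n] that
    by (simp add: algebra_simps)
  thus "\<exists>N. \<forall>m\<ge>N. \<forall>n\<ge>N. pabs (x m + y m - (x n + y n)) < e" by blast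
qed

text \<open>By the reverse triangle inequality the absolute values form a real Cauchy sequence.\<close>

lemma Cauchy_pabs_convergent:
  assumes "x \<in> carrier (padic_Cauchy p)"
  shows "convergent (\<lambda>n. pabs (x n))"
proof -
  have "Cauchy (\<lambda>n. pabs (x n))"
    unfolding Cauchy_def dist_real_def
    using assms pabs_abs_diff unfolding Cauchy_carrier_iff by (meson le_less_trans)
  thus ?thesis by (rule Cauchy_convergent)
qed

lemma Cauchy_bounded:
  assumes "x \<in> carrier (padic_Cauchy p)"
  obtains K where "K > 0" "\<And>n. pabs (x n) \<le> K"
  using convergent_imp_Bseq[OF Cauchy_pabs_convergent[OF assms]] unfolding Bseq_def by auto

lemma Cauchy_times:
  assumes "x \<in> carrier (padic_Cauchy p)" "y \<in> carrier (padic_Cauchy p)"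
  shows "(\<lambda>n. x n * y n) \<in> carrier (padic_Cauchy p)"
  unfolding Cauchy_carrier_iff
proof (intro allI impI)
  fix e :: real assume e: "e > 0"
  obtain K where K: "K > 0" "\<And>n. pabs (x n) \<le> K" using Cauchy_bounded[OF assms(1)] by blast
  obtain L where L: "L > 0" "\<And>n. pabs (y n) \<le> L" using Cauchy_bounded[OF assms(2)] by blast
  obtain N1 where N1: "\<And>m n. m \<ge> N1 \<Longrightarrow> n \<ge> N1 \<Longrightarrow> pabs (x m - x n) < e / L"
    using assms(1) e L unfolding Cauchy_carrier_iff by (meson divide_pos_pos)
  obtain N2 where N2: "\<And>m n. m \<ge> N2 \<Longrightarrow> n \<ge> N2 \<Longrightarrow> pabs (y m - y n) < e / K"
    using assms(2) e K unfolding Cauchy_carrier_iff by (meson divide_pos_pos)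
  have "pabs (x m * y m - x n * y n) < e" if "m \<ge> max N1 N2" "n \<ge> max N1 N2" for m n
  proof -
    have "pabs ((x m - x n) * y n) \<le> pabs (x m - x n) * L"
      unfolding pabs_mult using L by (intro mult_left_mono) auto
    also have "\<dots> < e" using N1[of m n] that L by (simp add: field_simps)
    finally have 1: "pabs ((x m - x n) * y n) < e" .
    have "pabs (x m * (y m - y n)) \<le> K * pabs (y m - y n)"
      unfolding pabs_mult using K by (intro mult_right_mono) auto
    also have "\<dots> < e" using N2[of m n] that K by (simp add: field_simps)
    finally have 2: "pabs (x m * (y m - y n)) < e" .
    have "x m * y m - x n * y n = (x m - x n) * y n + x m * (y m - y n)"
      by (simp add: algebra_simps)
    thus ?thesis using pabs_add[of "(x m - x n) * y n" "x m * (y m - y n)"] 1 2 by simp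
  qed
  thus "\<exists>N. \<forall>m\<ge>N. \<forall>n\<ge>N. pabs (x m * y m - x n * y n) < e" by blast
qed

lemma cring_Cauchy: "cring (padic_Cauchy p)"
proof (intro cringI abelian_groupI comm_monoidI)
  fix x assume "x \<in> carrier (padic_Cauchy p)"
  thus "\<exists>y\<in>carrier (padic_Cauchy p). y \<oplus>\<^bsub>padic_Cauchy p\<^esub> x = \<zero>\<^bsub>padic_Cauchy p\<^esub>"
    by (intro bexI[of _ "\<lambda>n. - x n"]) (auto simp: Cauchy_uminus)
qed (auto simp: Cauchy_plus Cauchy_times algebra_simps)

sublocale C: cring "padic_Cauchy p"
  by (rule cring_Cauchy)

lemma Cauchy_a_inv:
  assumes "x \<in> carrier (padic_Cauchy p)"
  shows "\<ominus>\<^bsub>padic_Cauchy p\<^esub> x = (\<lambda>n. - x n)"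
  using assms by (intro C.minus_equality) (auto simp: Cauchy_uminus)

lemma null_imp_Cauchy:
  assumes "x \<in> padic_null p"
  shows "x \<in> carrier (padic_Cauchy p)"
  unfolding Cauchy_carrier_iff
proof (intro allI impI)
  fix e :: real assume "e > 0"
  hence "\<forall>\<^sub>F n in sequentially. pabs (x n) < e"
    using assms unfolding padic_null_def by (auto intro: order_tendstoD)
  then obtain N where "\<And>n. n \<ge> N \<Longrightarrow> pabs (x n) < e"
    unfolding eventually_sequentially by auto
  hence "pabs (x m - x n) < e" if "m \<ge> N" "n \<ge> N" for m n
    using that by (intro le_less_trans[OF pabs_diff]) simp
  thus "\<exists>N. \<forall>m\<ge>N. \<forall>n\<ge>N. pabs (x m - x n) < e" by blast
qed

lemma null_plus:
  assumes "x \<in> padic_null p" "y \<in> padic_null p"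
  shows "(\<lambda>n. x n + y n) \<in> padic_null p"
proof -
  have "(\<lambda>n. max (pabs (x n)) (pabs (y n))) \<longlonglongrightarrow> max 0 0"
    using assms unfolding padic_null_def by (intro tendsto_max) auto
  hence "(\<lambda>n. pabs (x n + y n)) \<longlonglongrightarrow> 0"
    using pabs_add by (auto intro: Lim_null_comparison[rotated] always_eventually)
  thus ?thesis by (simp add: padic_null_def)
qed

lemma null_times:
  assumes "x \<in> padic_null p" "y \<in> carrier (padic_Cauchy p)"
  shows "(\<lambda>n. x n * y n) \<in> padic_null p"
proof -
  have "(\<lambda>n. pabs (x n) * pabs (y n)) \<longlonglongrightarrow> 0 * lim (\<lambda>n. pabs (y n))"
    using assms Cauchy_pabs_convergent unfolding padic_null_def
    by (intro tendsto_mult) (auto simp: convergent_LIMSEQ_iff)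
  thus ?thesis by (simp add: padic_null_def pabs_mult)
qed

lemma ideal_null: "ideal (padic_null p) (padic_Cauchy p)"
proof (rule idealI)
  show "subgroup (padic_null p) (add_monoid (padic_Cauchy p))"
  proof (rule C.add.subgroupI)
    show "padic_null p \<subseteq> carrier (padic_Cauchy p)"
      using null_imp_Cauchy by auto
    show "padic_null p \<noteq> {}"
      by (auto simp: padic_null_def intro!: exI[of _ "\<lambda>n. 0"])
    show "\<ominus>\<^bsub>padic_Cauchy p\<^esub> x \<in> padic_null p" if "x \<in> padic_null p" for x
      using that null_imp_Cauchy[OF that] by (simp add: Cauchy_a_inv padic_null_def)
  qed (simp add: null_plus)
  show "x \<otimes>\<^bsub>padic_Cauchy p\<^esub> a \<in> padic_null p" "a \<otimes>\<^bsub>padic_Cauchy p\<^esub> x \<in> padic_null p"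
    if "a \<in> padic_null p" "x \<in> carrier (padic_Cauchy p)" for a x
    using null_times[OF that] by (simp_all add: mult.commute)
qed (rule C.ring_axioms)

sublocale N: ideal "padic_null p" "padic_Cauchy p"
  by (rule ideal_null)

sublocale Q: cring "Qp p"
  unfolding Qp_def by (rule N.quotient_is_cring[OF cring_Cauchy])

abbreviation cls :: "(nat \<Rightarrow> rat) \<Rightarrow> (nat \<Rightarrow> rat) set" where
  "cls x \<equiv> padic_null p +>\<^bsub>padic_Cauchy p\<^esub> x"

abbreviation qabs :: "(nat \<Rightarrow> rat) set \<Rightarrow> real" where "qabs \<equiv> Qp_abs p"
abbreviation qrat :: "rat \<Rightarrow> (nat \<Rightarrow> rat) set" where "qrat \<equiv> Qp_of_rat p"

sublocale H: ring_hom_cring "padic_Cauchy p" "Qp p" cls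
  unfolding Qp_def by (rule N.rcos_ring_hom_cring[OF cring_Cauchy])

lemma Qp_obtain_rep:
  assumes "X \<in> carrier (Qp p)"
  obtains x where "x \<in> carrier (padic_Cauchy p)" "X = cls x"
  using assms unfolding Qp_def FactRing_def A_RCOSETS_def' by auto

lemma cls_eq_zero_iff:
  assumes "x \<in> carrier (padic_Cauchy p)"
  shows "cls x = \<zero>\<^bsub>Qp p\<^esub> \<longleftrightarrow> x \<in> padic_null p"
proof -
  have "\<zero>\<^bsub>Qp p\<^esub> = padic_null p" by (simp add: Qp_def FactRing_def)
  thus ?thesis
    using assms N.a_rcos_self[OF assms] C.a_coset_join2[OF assms N.a_subgroup] by auto
qed

text \<open>The limit defining the absolute value is independent of the representative because
  two representatives differ by a null sequence.\<close>

lemma tendsto_qabs: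
  assumes "x \<in> carrier (padic_Cauchy p)"
  shows "(\<lambda>n. pabs (x n)) \<longlonglongrightarrow> qabs (cls x)"
proof -
  define l where "l = lim (\<lambda>n. pabs (x n))"
  have l: "(\<lambda>n. pabs (x n)) \<longlonglongrightarrow> l"
    using Cauchy_pabs_convergent[OF assms] by (simp add: convergent_LIMSEQ_iff l_def)
  have all: "(\<lambda>n. pabs (y n)) \<longlonglongrightarrow> l" if y: "y \<in> cls x" for y
  proof -
    obtain h where h: "h \<in> padic_null p" "y = (\<lambda>n. h n + x n)"
      using y unfolding a_r_coset_def' Cauchy_simps by blast
    have "(\<lambda>n. pabs (y n) - pabs (x n)) \<longlonglongrightarrow> 0"
    proof (rule Lim_null_comparison)
      show "\<forall>\<^sub>F n in sequentially. norm (pabs (y n) - pabs (x n)) \<le> pabs (h n)"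
        using pabs_abs_diff h(2) by (intro always_eventually) (metis add_diff_cancel_right' real_norm_def)
      show "(\<lambda>n. pabs (h n)) \<longlonglongrightarrow> 0" using h(1) by (simp add: padic_null_def)
    qed
    from tendsto_add[OF this l] show ?thesis by simp
  qed
  have "x \<in> cls x" using assms by (rule N.a_rcos_self)
  hence "qabs (cls x) = l"
    unfolding Qp_abs_def using all by (intro the_equality) (auto intro: LIMSEQ_unique)
  thus ?thesis using l by simp
qed

lemma qabs_nonneg [simp]: "X \<in> carrier (Qp p) \<Longrightarrow> 0 \<le> qabs X"
  by (erule Qp_obtain_rep) (auto intro!: LIMSEQ_le_const[OF tendsto_qabs])

lemma qabs_eq_0_iff: "X \<in> carrier (Qp p) \<Longrightarrow> qabs X = 0 \<longleftrightarrow> X = \<zero>\<^bsub>Qp p\<^esub>"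
proof (erule Qp_obtain_rep)
  fix x assume x: "x \<in> carrier (padic_Cauchy p)" "X = cls x"
  show "qabs X = 0 \<longleftrightarrow> X = \<zero>\<^bsub>Qp p\<^esub>"
    using tendsto_qabs[OF x(1)] x cls_eq_zero_iff[OF x(1)]
    by (auto simp: padic_null_def intro: LIMSEQ_unique)
qed

lemma qabs_mult:
  assumes "X \<in> carrier (Qp p)" "Y \<in> carrier (Qp p)"
  shows "qabs (X \<otimes>\<^bsub>Qp p\<^esub> Y) = qabs X * qabs Y"
proof -
  obtain x where x: "x \<in> carrier (padic_Cauchy p)" "X = cls x" using Qp_obtain_rep[OF assms(1)] .
  obtain y where y: "y \<in> carrier (padic_Cauchy p)" "Y = cls y" using Qp_obtain_rep[OF assms(2)] .
  have "X \<otimes>\<^bsub>Qp p\<^esub> Y = cls (\<lambda>n. x n * y n)"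
    using H.hom_mult[OF x(1) y(1)] x y by simp
  moreover have "(\<lambda>n. pabs (x n * y n)) \<longlonglongrightarrow> qabs X * qabs Y"
    unfolding pabs_mult using x y by (intro tendsto_mult) (auto intro: tendsto_qabs)
  ultimately show ?thesis
    using tendsto_qabs[OF Cauchy_times[OF x(1) y(1)]] by (auto intro: LIMSEQ_unique)
qed

lemma qabs_add:
  assumes "X \<in> carrier (Qp p)" "Y \<in> carrier (Qp p)"
  shows "qabs (X \<oplus>\<^bsub>Qp p\<^esub> Y) \<le> max (qabs X) (qabs Y)"
proof -
  obtain x where x: "x \<in> carrier (padic_Cauchy p)" "X = cls x" using Qp_obtain_rep[OF assms(1)] .
  obtain y where y: "y \<in> carrier (padic_Cauchy p)" "Y = cls y" using Qp_obtain_rep[OF assms(2)] .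
  have eq: "X \<oplus>\<^bsub>Qp p\<^esub> Y = cls (\<lambda>n. x n + y n)"
    using H.hom_add[OF x(1) y(1)] x y by simp
  have "(\<lambda>n. max (pabs (x n)) (pabs (y n))) \<longlonglongrightarrow> max (qabs X) (qabs Y)"
    using x y by (intro tendsto_max) (auto intro: tendsto_qabs)
  with tendsto_qabs[OF Cauchy_plus[OF x(1) y(1)]] show ?thesis
    unfolding eq by (rule LIMSEQ_le) (auto simp: pabs_add)
qed

lemma cls_a_inv: "x \<in> carrier (padic_Cauchy p) \<Longrightarrow> \<ominus>\<^bsub>Qp p\<^esub> cls x = cls (\<lambda>n. - x n)"
  using H.hom_a_inv[of x] Cauchy_a_inv[of x] by simp

lemma qabs_minus [simp]:
  assumes "X \<in> carrier (Qp p)"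
  shows "qabs (\<ominus>\<^bsub>Qp p\<^esub> X) = qabs X"
proof -
  obtain x where x: "x \<in> carrier (padic_Cauchy p)" "X = cls x" using Qp_obtain_rep[OF assms] .
  show ?thesis
    using tendsto_qabs[OF Cauchy_uminus[OF x(1)]] tendsto_qabs[OF x(1)] cls_a_inv[OF x(1)] x(2)
    by (auto intro: LIMSEQ_unique)
qed

lemma qabs_diff:
  assumes "X \<in> carrier (Qp p)" "Y \<in> carrier (Qp p)"
  shows "qabs (X \<ominus>\<^bsub>Qp p\<^esub> Y) \<le> max (qabs X) (qabs Y)"
  using qabs_add[of X "\<ominus>\<^bsub>Qp p\<^esub> Y"] assms by (simp add: a_minus_def)

lemma qrat_carrier [simp]: "qrat r \<in> carrier (Qp p)"
  by (simp add: Qp_of_rat_def)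

lemma qabs_qrat [simp]: "qabs (qrat r) = pabs r"
  using tendsto_qabs[of "\<lambda>n. r"] unfolding Qp_of_rat_def by (auto intro: LIMSEQ_unique)

lemma qrat_0: "qrat 0 = \<zero>\<^bsub>Qp p\<^esub>"
  and qrat_1: "qrat 1 = \<one>\<^bsub>Qp p\<^esub>"
  using H.hom_zero H.hom_one unfolding Qp_of_rat_def by simp_all

lemma qrat_add: "qrat (r + s) = qrat r \<oplus>\<^bsub>Qp p\<^esub> qrat s"
  and qrat_mult: "qrat (r * s) = qrat r \<otimes>\<^bsub>Qp p\<^esub> qrat s"
  using H.hom_add[of "\<lambda>n. r" "\<lambda>n. s"] H.hom_mult[of "\<lambda>n. r" "\<lambda>n. s"]
  unfolding Qp_of_rat_def by simp_all

lemma qrat_minus: "qrat (- r) = \<ominus>\<^bsub>Qp p\<^esub> qrat r"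
  using cls_a_inv[of "\<lambda>n. r"] unfolding Qp_of_rat_def by simp

lemma qrat_diff: "qrat (r - s) = qrat r \<ominus>\<^bsub>Qp p\<^esub> qrat s"
  using qrat_add[of r "- s"] by (simp add: qrat_minus a_minus_def)

text \<open>The rationals are dense: a Cauchy sequence is approximated by its own terms.\<close>

lemma rat_approximation:
  assumes "X \<in> carrier (Qp p)" "e > 0"
  obtains r where "qabs (X \<ominus>\<^bsub>Qp p\<^esub> qrat r) < e"
proof -
  obtain x where x: "x \<in> carrier (padic_Cauchy p)" "X = cls x" using Qp_obtain_rep[OF assms(1)] .
  have "\<exists>N. \<forall>m\<ge>N. \<forall>n\<ge>N. pabs (x m - x n) < e / 2"
    using x(1) assms(2) unfolding Cauchy_carrier_iff by (meson half_gt_zero)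
  then obtain N where N: "\<And>m n. m \<ge> N \<Longrightarrow> n \<ge> N \<Longrightarrow> pabs (x m - x n) < e / 2" by meson
  let ?y = "\<lambda>n. x n + - x N"
  have y: "?y \<in> carrier (padic_Cauchy p)"
    by (intro Cauchy_plus x Cauchy_const)
  have "X \<ominus>\<^bsub>Qp p\<^esub> qrat (x N) = X \<oplus>\<^bsub>Qp p\<^esub> qrat (- x N)"
    by (simp add: a_minus_def qrat_minus)
  also have "\<dots> = cls ?y"
    using H.hom_add[OF x(1), of "\<lambda>n. - x N"] x(2) unfolding Qp_of_rat_def by simp
  finally have eq: "X \<ominus>\<^bsub>Qp p\<^esub> qrat (x N) = cls ?y" .
  have "qabs (cls ?y) \<le> e / 2"
    by (rule LIMSEQ_le_const2[OF tendsto_qabs[OF y]])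
       (use N in \<open>auto intro!: exI[of _ N] less_imp_le\<close>)
  thus ?thesis using that[of "x N"] assms(2) unfolding eq by simp
qed

text \<open>The strict ultrametric property makes every nonzero absolute value that of a rational.\<close>

lemma rat_approximation_same_abs:
  assumes "X \<in> carrier (Qp p)" "X \<noteq> \<zero>\<^bsub>Qp p\<^esub>" "0 < e" "e \<le> 1"
  obtains r where "r \<noteq> 0" "qabs X = pabs r" "qabs (X \<ominus>\<^bsub>Qp p\<^esub> qrat r) < e * pabs r"
proof -
  have pos: "qabs X > 0" using assms qabs_eq_0_iff[of X] qabs_nonneg[of X] by linarith
  obtain r where r: "qabs (X \<ominus>\<^bsub>Qp p\<^esub> qrat r) < e * qabs X"
    using rat_approximation[OF assms(1), of "e * qabs X"] pos assms by auto
  let ?D = "X \<ominus>\<^bsub>Qp p\<^esub> qrat r"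
  have D: "?D \<in> carrier (Qp p)" using assms by simp
  have eX: "e * qabs X \<le> qabs X" using pos assms by simp
  have "X = ?D \<oplus>\<^bsub>Qp p\<^esub> qrat r"
    using assms(1) by (simp add: a_minus_def Q.a_assoc Q.l_neg)
  hence 1: "qabs X \<le> max (qabs ?D) (pabs r)"
    using qabs_add[OF D qrat_carrier[of r]] by simp
  have "qrat r = X \<ominus>\<^bsub>Qp p\<^esub> ?D"
    using assms(1) D by (simp add: a_minus_def Q.minus_add Q.minus_minus Q.a_assoc[symmetric] Q.r_neg)
  hence 2: "pabs r \<le> max (qabs X) (qabs ?D)"
    using qabs_diff[OF assms(1) D] by (metis qabs_qrat)
  have eq: "qabs X = pabs r" using 1 2 r eX by linarith
  hence "r \<noteq> 0" using pos by auto
  thus ?thesis using that[of r] eq r by simp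
qed

end

section \<open>The fractional part and the standard character\<close>

context padic
begin

text \<open>The value group is discrete: a rational of absolute value less than \<open>1\<close> is close to an integer
  that must then be divisible by \<open>p\<close>.\<close>

lemma pabs_less_1:
  assumes "pabs r < 1"
  shows "pabs r \<le> 1 / real p"
proof -
  obtain b where b: "pabs (r - of_int b) \<le> 1 / real p"
    using int_approximation[of r 1] assms by auto
  have "pabs (of_int b) \<le> max (pabs (r - of_int b)) (pabs r)"
    using pabs_diff[of r "r - of_int b"] by (simp add: max.commute)
  also have "\<dots> < 1" using b assms p_real_gt_1 by (auto intro: le_less_trans)
  finally have lt: "pabs (of_int b) < 1" .
  have "int p dvd b"
  proof (rule ccontr)
    assume "\<not> int p dvd b"
    hence "b \<noteq> 0" "mul b = 0" by (auto simp: not_dvd_imp_multiplicity_0)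
    thus False using lt by (simp add: pabs_of_int)
  qed
  hence "pabs (of_int b) \<le> 1 / real p" using pabs_of_int_le_iff[of b 1] by simp
  thus ?thesis using pabs_add[of "r - of_int b" "of_int b"] b by simp
qed

definition p_fraction :: "rat \<Rightarrow> bool" where
  "p_fraction r \<longleftrightarrow> (\<exists>(a::int) (k::nat). r = of_int a / of_nat p ^ k)"

lemma p_fractionI: "p_fraction (of_int a / of_nat p ^ k)"
  unfolding p_fraction_def by blast

lemma p_fraction_add:
  assumes "p_fraction r" "p_fraction s"
  shows "p_fraction (r + s)"
proof -
  obtain a k b l where r: "r = of_int a / of_nat p ^ k" and s: "s = of_int b / of_nat p ^ l"
    using assms unfolding p_fraction_def by blast
  have "r + s = of_int (a * int p ^ l + b * int p ^ k) / of_nat p ^ (k + l)"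
    unfolding r s using p_pos by (simp add: field_simps power_add)
  thus ?thesis by (metis p_fractionI)
qed

lemma p_fraction_minus: "p_fraction r \<Longrightarrow> p_fraction (- r)"
  unfolding p_fraction_def by (metis minus_divide_left of_int_minus)

lemma p_fraction_0: "p_fraction 0"
  using p_fractionI[of 0 0] by simp

lemma Zp_iff: "X \<in> Zp p \<longleftrightarrow> X \<in> carrier (Qp p) \<and> qabs X \<le> 1"
  by (auto simp: Zp_def)

lemma Zp_add: "X \<in> Zp p \<Longrightarrow> Y \<in> Zp p \<Longrightarrow> X \<oplus>\<^bsub>Qp p\<^esub> Y \<in> Zp p"
  unfolding Zp_iff using qabs_add[of X Y] by auto

lemma Zp_diff: "X \<in> Zp p \<Longrightarrow> Y \<in> Zp p \<Longrightarrow> X \<ominus>\<^bsub>Qp p\<^esub> Y \<in> Zp p"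
  unfolding Zp_iff using qabs_diff[of X Y] by auto

text \<open>Two fractional parts of the same number differ by an element of \<open>\<int>[1/p] \<inter> \<int>\<^sub>p = \<int>\<close>.\<close>

lemma p_fraction_part_unique:
  assumes "X \<in> carrier (Qp p)" "p_fraction r" "p_fraction s"
    and "X \<ominus>\<^bsub>Qp p\<^esub> qrat r \<in> Zp p" "X \<ominus>\<^bsub>Qp p\<^esub> qrat s \<in> Zp p"
  shows "r - s \<in> \<int>"
proof -
  have "(X \<ominus>\<^bsub>Qp p\<^esub> qrat s) \<ominus>\<^bsub>Qp p\<^esub> (X \<ominus>\<^bsub>Qp p\<^esub> qrat r)
      = (X \<oplus>\<^bsub>Qp p\<^esub> \<ominus>\<^bsub>Qp p\<^esub> X) \<oplus>\<^bsub>Qp p\<^esub> (qrat r \<ominus>\<^bsub>Qp p\<^esub> qrat s)"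
    using assms(1) by (simp add: a_minus_def Q.minus_add Q.a_ac)
  also have "\<dots> = qrat (r - s)"
    using assms(1) by (simp add: Q.r_neg qrat_diff)
  finally have "qrat (r - s) \<in> Zp p"
    using Zp_diff[OF assms(5,4)] by simp
  hence "pabs (r - s) \<le> 1" by (simp add: Zp_iff)
  moreover have "p_fraction (r - s)"
    using p_fraction_add[OF assms(2) p_fraction_minus[OF assms(3)]] by simp
  ultimately show ?thesis
    unfolding p_fraction_def using p_fraction_integral by blast
qed

text \<open>After replacing \<open>X\<close> by a nearby rational \<open>a\<close>, multiply by a power \<open>p ^ k\<close> that makes it integral,
  approximate the product by an integer modulo \<open>p ^ k\<close>, and reduce that integer to \<open>[0, p ^ k)\<close>.\<close>

lemma p_fraction_part_exists:
  assumes "X \<in> carrier (Qp p)"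
  obtains r where "0 \<le> r" "r < 1" "p_fraction r" "X \<ominus>\<^bsub>Qp p\<^esub> qrat r \<in> Zp p"
proof -
  obtain a where a: "qabs (X \<ominus>\<^bsub>Qp p\<^esub> qrat a) < 1"
    using rat_approximation[OF assms, of 1] by auto
  obtain k where k: "pabs a < real p ^ k"
    using real_arch_pow[OF p_real_gt_1] by blast
  have pk: "pabs (of_nat p ^ k) = 1 / real p ^ k"
    by (simp add: pabs_power pabs_p power_divide)
  have "pabs (a * of_nat p ^ k) \<le> 1"
    using k p_pos by (simp add: pabs_mult pk field_simps)
  then obtain b where b: "pabs (a * of_nat p ^ k - of_int b) \<le> 1 / real p ^ k"
    using int_approximation by blast
  define r :: rat where "r = of_int (b mod int p ^ k) / of_nat p ^ k"
  have nz: "(of_nat p :: rat) ^ k \<noteq> 0" using p_pos by simp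
  have "a - of_int b / of_nat p ^ k = (a * of_nat p ^ k - of_int b) / of_nat p ^ k"
    using nz by (simp add: field_simps)
  hence 1: "pabs (a - of_int b / of_nat p ^ k) \<le> 1"
    using b p_pos by (simp add: pabs_divide pk field_simps)
  have "of_int b = (of_int (b div int p ^ k * int p ^ k + b mod int p ^ k) :: rat)"
    by (simp only: div_mult_mod_eq)
  hence "of_int b / of_nat p ^ k - r = of_int (b div int p ^ k)"
    using nz unfolding r_def of_int_add of_int_mult by (simp add: field_simps)
  hence 2: "pabs (of_int b / of_nat p ^ k - r) \<le> 1"
    using pabs_of_int_le_1 by simp
  have 3: "pabs (a - r) \<le> 1"
    using pabs_add[of "a - of_int b / of_nat p ^ k" "of_int b / of_nat p ^ k - r"] 1 2 by simp
  have "(X \<ominus>\<^bsub>Qp p\<^esub> qrat a) \<oplus>\<^bsub>Qp p\<^esub> qrat (a - r) = X \<ominus>\<^bsub>Qp p\<^esub> qrat r"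
    using assms by (simp add: a_minus_def qrat_diff Q.a_assoc Q.r_neg1)
  moreover have "(X \<ominus>\<^bsub>Qp p\<^esub> qrat a) \<in> Zp p" "qrat (a - r) \<in> Zp p"
    using a 3 assms by (simp_all add: Zp_iff)
  ultimately have 4: "X \<ominus>\<^bsub>Qp p\<^esub> qrat r \<in> Zp p"
    using Zp_add by metis
  have "0 \<le> b mod int p ^ k" "b mod int p ^ k < int p ^ k" using p_pos by simp_all
  hence "0 \<le> r" "of_int (b mod int p ^ k) < (of_int (int p ^ k) :: rat)"
    unfolding r_def of_int_less_iff by simp_all
  hence "0 \<le> r" "r < 1" using p_pos by (simp_all add: r_def)
  thus ?thesis using that 4 p_fractionI[of "b mod int p ^ k" k] unfolding r_def by blast
qed

lemma Qp_frac_props: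
  assumes "X \<in> carrier (Qp p)"
  shows "p_fraction (Qp_frac p X)" "X \<ominus>\<^bsub>Qp p\<^esub> qrat (Qp_frac p X) \<in> Zp p"
proof -
  let ?P = "\<lambda>r. 0 \<le> r \<and> r < 1 \<and> p_fraction r \<and> X \<ominus>\<^bsub>Qp p\<^esub> qrat r \<in> Zp p"
  obtain r where r: "?P r" using p_fraction_part_exists[OF assms] by blast
  have "s = r" if s: "?P s" for s
  proof -
    obtain n :: int where n: "s - r = of_int n"
      using p_fraction_part_unique[OF assms, of s r] r s by (auto elim: Ints_cases)
    have "-1 < (of_int n :: rat)" "(of_int n :: rat) < 1" unfolding n[symmetric] using r s by auto
    hence "n = 0" by linarith
    thus ?thesis using n by simp
  qed
  hence "?P (THE r. ?P r)" using r by (intro theI[of ?P])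
  thus "p_fraction (Qp_frac p X)" "X \<ominus>\<^bsub>Qp p\<^esub> qrat (Qp_frac p X) \<in> Zp p"
    unfolding Qp_frac_def p_fraction_def by simp_all
qed

definition Qp_char :: "(nat \<Rightarrow> rat) set \<Rightarrow> complex" where
  "Qp_char X = exp (2 * complex_of_real pi * \<i> * of_rat (Qp_frac p X))"

text \<open>The character may be computed from any element of \<open>\<int>[1/p]\<close> congruent to \<open>X\<close> modulo \<open>\<int>\<^sub>p\<close>, not
  only from the normalised one in \<open>[0,1)\<close>: the two differ by an integer.  Additivity follows,
  although the fractional part itself is not additive.\<close>

lemma Qp_char_eqI:
  assumes "X \<in> carrier (Qp p)" "p_fraction r" "X \<ominus>\<^bsub>Qp p\<^esub> qrat r \<in> Zp p"
  shows "Qp_char X = exp (2 * complex_of_real pi * \<i> * of_rat r)"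
proof -
  obtain n :: int where "Qp_frac p X - r = of_int n"
    using p_fraction_part_unique[OF assms(1) _ assms(2) _ assms(3)] Qp_frac_props[OF assms(1)]
    by (auto elim: Ints_cases)
  hence "Qp_frac p X = r + of_int n" by simp
  hence "(of_rat (Qp_frac p X) :: complex) = of_rat r + of_int n"
    by (simp add: of_rat_add)
  hence "Qp_char X = exp (2 * complex_of_real pi * \<i> * of_rat r + 2 * of_int n * complex_of_real pi * \<i>)"
    by (simp add: Qp_char_def algebra_simps)
  moreover have "exp (2 * of_int n * complex_of_real pi * \<i>) = 1"
    unfolding exp_eq_1 by auto
  ultimately show ?thesis by (simp add: exp_add)
qed

lemma Qp_char_Zp: "X \<in> Zp p \<Longrightarrow> Qp_char X = 1"
  using Qp_char_eqI[of X 0] p_fraction_0 by (simp add: Zp_iff qrat_0 a_minus_def)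

lemma Qp_char_add:
  assumes "X \<in> carrier (Qp p)" "Y \<in> carrier (Qp p)"
  shows "Qp_char (X \<oplus>\<^bsub>Qp p\<^esub> Y) = Qp_char X * Qp_char Y"
proof -
  let ?r = "Qp_frac p X" and ?s = "Qp_frac p Y"
  have "(X \<oplus>\<^bsub>Qp p\<^esub> Y) \<ominus>\<^bsub>Qp p\<^esub> qrat (?r + ?s)
      = (X \<ominus>\<^bsub>Qp p\<^esub> qrat ?r) \<oplus>\<^bsub>Qp p\<^esub> (Y \<ominus>\<^bsub>Qp p\<^esub> qrat ?s)"
    using assms by (simp add: a_minus_def qrat_add Q.minus_add Q.a_ac)
  also have "\<dots> \<in> Zp p" by (intro Zp_add Qp_frac_props assms)
  finally have "Qp_char (X \<oplus>\<^bsub>Qp p\<^esub> Y) = exp (2 * complex_of_real pi * \<i> * of_rat (?r + ?s))"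
    using assms by (intro Qp_char_eqI p_fraction_add Qp_frac_props) auto
  thus ?thesis by (simp add: Qp_char_def of_rat_add ring_distribs exp_add)
qed

lemma norm_Qp_char [simp]: "norm (Qp_char X) = 1"
proof -
  obtain a b :: int where "Qp_frac p X = of_int a / of_int b"
    using quotient_of_div by (metis surj_pair)
  hence "2 * complex_of_real pi * \<i> * of_rat (Qp_frac p X)
      = \<i> * complex_of_real (2 * pi * (of_int a / of_int b))"
    by (simp add: of_rat_divide)
  thus ?thesis unfolding Qp_char_def by (simp only: norm_exp_i_times)
qed

lemma Qp_char_nontrivial:
  assumes "X \<in> carrier (Qp p)" "X \<ominus>\<^bsub>Qp p\<^esub> qrat (1 / of_nat p) \<in> Zp p"
  shows "Qp_char X \<noteq> 1"
proof
  assume "Qp_char X = 1"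
  moreover have "Qp_char X = exp (2 * complex_of_real pi * \<i> * of_rat (1 / of_nat p))"
    using assms p_fractionI[of 1 1] by (intro Qp_char_eqI) auto
  ultimately have "exp (2 * complex_of_real pi * \<i> * of_rat (1 / of_nat p)) = 1" by simp
  moreover have "2 * complex_of_real pi * \<i> * of_rat (1 / of_nat p)
      = Complex 0 (2 * pi / real p)"
    by (simp add: of_rat_divide complex_eq_iff)
  ultimately have "exp (Complex 0 (2 * pi / real p)) = 1" by simp
  then obtain n :: int where "2 * pi / real p = of_int (2 * n) * pi"
    unfolding exp_eq_1 by auto
  hence "(1 / real p) * (2 * pi) = of_int n * (2 * pi)" by simp
  hence "1 / real p = of_int n" by (simp only: mult_cancel_right) simp
  moreover have "0 < 1 / real p" "1 / real p < 1" using p_real_gt_1 by simp_all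
  ultimately have "0 < real_of_int n" "real_of_int n < 1" by metis+
  thus False by simp
qed

text \<open>The balls of radii \<open>\<bar>r\<bar>\<close> and \<open>1 / \<bar>r\<bar>\<close> are annihilators of each other: for \<open>X\<close> outside the
  latter, \<open>Y\<close> is taken to be an approximate inverse of \<open>p X\<close>, so that the product is close to \<open>1 / p\<close>.\<close>

lemma Qp_char_detects:
  assumes "X \<in> carrier (Qp p)" "r \<noteq> 0" "qabs X > 1 / pabs r"
  obtains Y where "Y \<in> carrier (Qp p)" "qabs Y \<le> pabs r" "Qp_char (X \<otimes>\<^bsub>Qp p\<^esub> Y) \<noteq> 1"
proof -
  have "0 < 1 / pabs r" using pabs_pos[OF assms(2)] by simp
  hence nz: "X \<noteq> \<zero>\<^bsub>Qp p\<^esub>" using assms(1,3) qabs_eq_0_iff[OF assms(1)] by linarith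
  obtain a where a: "a \<noteq> 0" "qabs X = pabs a" "qabs (X \<ominus>\<^bsub>Qp p\<^esub> qrat a) < 1 / real p * pabs a"
    using rat_approximation_same_abs[OF assms(1) nz, of "1 / real p"] p_real_gt_1 by auto
  \<comment> \<open>\<open>a\<close> agrees with \<open>X\<close> up to relative error less than \<open>1 / p\<close>, so \<open>X Y\<close> agrees with \<open>1 / p\<close> modulo \<open>\<int>\<^sub>p\<close>.\<close>
  define Y where "Y = qrat (1 / (a * of_nat p))"
  have absY: "qabs Y = real p / pabs a"
    by (simp add: Y_def pabs_divide pabs_mult pabs_p)
  \<comment> \<open>The absolute value of \<open>a r\<close> exceeds \<open>1\<close>, hence is at least \<open>p\<close> by discreteness.\<close>
  have "real p \<le> pabs (a * r)"
  proof (rule ccontr)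
    assume "\<not> real p \<le> pabs (a * r)"
    hence lt: "pabs (a * r * of_nat p) < 1"
      using p_pos by (simp add: pabs_mult pabs_p field_simps)
    hence "pabs (a * r * of_nat p) \<le> 1 / real p" by (rule pabs_less_1)
    hence "pabs (a * r) \<le> 1"
      using p_pos by (simp add: pabs_mult pabs_p field_simps)
    thus False
      using assms(3) a(2) pabs_pos[OF assms(2)] by (simp add: pabs_mult field_simps)
  qed
  hence "qabs Y \<le> pabs r"
    using pabs_pos[OF a(1)] by (simp add: absY pabs_mult field_simps)
  moreover have Yc: "Y \<in> carrier (Qp p)" by (simp add: Y_def)
  moreover have "Qp_char (X \<otimes>\<^bsub>Qp p\<^esub> Y) \<noteq> 1"
  proof (rule Qp_char_nontrivial)
    have "qrat (1 / of_nat p) = qrat a \<otimes>\<^bsub>Qp p\<^esub> Y"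
      unfolding Y_def qrat_mult[symmetric] using a(1) by simp
    hence "(X \<otimes>\<^bsub>Qp p\<^esub> Y) \<ominus>\<^bsub>Qp p\<^esub> qrat (1 / of_nat p) = (X \<ominus>\<^bsub>Qp p\<^esub> qrat a) \<otimes>\<^bsub>Qp p\<^esub> Y"
      using assms(1) Yc by (simp add: a_minus_def Q.l_distr Q.l_minus)
    moreover have "qabs ((X \<ominus>\<^bsub>Qp p\<^esub> qrat a) \<otimes>\<^bsub>Qp p\<^esub> Y) \<le> 1"
      using a(3) assms(1) Yc pabs_pos[OF a(1)] p_pos
      by (simp add: qabs_mult absY field_simps)
    ultimately show "(X \<otimes>\<^bsub>Qp p\<^esub> Y) \<ominus>\<^bsub>Qp p\<^esub> qrat (1 / of_nat p) \<in> Zp p"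
      using assms(1) Yc by (simp add: Zp_iff)
  qed (use assms Yc in simp)
  ultimately show ?thesis using that by blast
qed

end

section \<open>Balls, cosets and characters in the product ring\<close>

context padic
begin

text \<open>The ball of radius \<open>\<bar>r / p\<bar> = p \<bar>r\<bar>\<close> modulo the ball of radius \<open>\<bar>r\<bar>\<close> is a copy of \<open>\<int>\<^sub>p / p \<int>\<^sub>p\<close>, which is
  represented by the digits \<open>0, \<dots>, p - 1\<close>.\<close>

lemma residue_approximation:
  assumes "X \<in> carrier (Qp p)" "r \<noteq> 0" "qabs X \<le> pabs (r / of_nat p)"
  obtains j :: nat where "j < p" "qabs (X \<ominus>\<^bsub>Qp p\<^esub> qrat (of_nat j * r / of_nat p)) \<le> pabs r"
proof -
  have r: "pabs r > 0" using assms by (simp add: pabs_pos)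
  have rp: "pabs (r / of_nat p) = real p * pabs r"
    by (simp add: pabs_divide pabs_p)
  obtain a where a: "qabs (X \<ominus>\<^bsub>Qp p\<^esub> qrat a) < pabs r"
    using rat_approximation[OF assms(1) r] by blast
  have Xa: "X \<ominus>\<^bsub>Qp p\<^esub> qrat a \<in> carrier (Qp p)" using assms(1) by simp
  have "qrat a = X \<ominus>\<^bsub>Qp p\<^esub> (X \<ominus>\<^bsub>Qp p\<^esub> qrat a)"
    using assms(1) by (simp add: a_minus_def Q.minus_add Q.minus_minus Q.a_assoc[symmetric] Q.r_neg)
  hence "pabs a \<le> max (qabs X) (qabs (X \<ominus>\<^bsub>Qp p\<^esub> qrat a))"
    using qabs_diff[OF assms(1) Xa] by (metis qabs_qrat)
  also have "\<dots> \<le> real p * pabs r"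
    using a assms(3) mult_right_mono[of 1 "real p" "pabs r"] p_real_gt_1 unfolding rp
    by (simp del: mult_le_cancel_right1 mult_le_cancel_right2)
  finally have "pabs (a * of_nat p / r) \<le> 1"
    using r p_pos by (simp add: pabs_divide pabs_mult pabs_p field_simps)
  then obtain b where b: "pabs (a * of_nat p / r - of_int b) \<le> 1 / real p"
    using int_approximation[of _ 1] by fastforce
  define j where "j = nat (b mod int p)"
  have j: "j < p" "int j = b mod int p" using p_pos by (auto simp: j_def nat_less_iff)
  have "int p dvd b - int j" by (simp add: j(2) mod_eq_dvd_iff[symmetric])
  hence "pabs (of_int (b - int j)) \<le> 1 / real p"
    using pabs_of_int_le_iff[of "b - int j" 1] by simp
  hence "pabs (a * of_nat p / r - of_nat j) \<le> 1 / real p"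
    using pabs_add[of "a * of_nat p / r - of_int b" "of_int (b - int j)"] b by simp
  moreover have "a - of_nat j * r / of_nat p = (a * of_nat p / r - of_nat j) * (r / of_nat p)"
    using assms(2) p_pos by (simp add: field_simps)
  ultimately have "pabs (a - of_nat j * r / of_nat p) \<le> 1 / real p * (real p * pabs r)"
    unfolding rp[symmetric] by (simp only: pabs_mult) (rule mult_right_mono, auto)
  hence c: "pabs (a - of_nat j * r / of_nat p) \<le> pabs r" using p_pos by simp
  have "X \<ominus>\<^bsub>Qp p\<^esub> qrat (of_nat j * r / of_nat p)
      = (X \<ominus>\<^bsub>Qp p\<^esub> qrat a) \<oplus>\<^bsub>Qp p\<^esub> qrat (a - of_nat j * r / of_nat p)"
    using assms(1) by (simp add: a_minus_def qrat_diff Q.a_assoc Q.r_neg1)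
  hence "qabs (X \<ominus>\<^bsub>Qp p\<^esub> qrat (of_nat j * r / of_nat p)) \<le> pabs r"
    using qabs_add[OF Xa qrat_carrier[of "a - of_nat j * r / of_nat p"]] a c by simp
  thus ?thesis using that j by blast
qed

lemma Qp_swap_summands:
  assumes "A \<in> carrier (Qp p)" "B \<in> carrier (Qp p)" "X \<in> carrier (Qp p)" "Y \<in> carrier (Qp p)"
    and "A \<oplus>\<^bsub>Qp p\<^esub> X = B \<oplus>\<^bsub>Qp p\<^esub> Y"
  shows "A \<ominus>\<^bsub>Qp p\<^esub> B = Y \<ominus>\<^bsub>Qp p\<^esub> X"
proof -
  have "A \<ominus>\<^bsub>Qp p\<^esub> B = (A \<oplus>\<^bsub>Qp p\<^esub> X) \<oplus>\<^bsub>Qp p\<^esub> (\<ominus>\<^bsub>Qp p\<^esub> X \<oplus>\<^bsub>Qp p\<^esub> \<ominus>\<^bsub>Qp p\<^esub> B)"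
    using assms(1-4) by (simp add: a_minus_def Q.a_assoc Q.r_neg2)
  also have "\<dots> = (B \<oplus>\<^bsub>Qp p\<^esub> \<ominus>\<^bsub>Qp p\<^esub> B) \<oplus>\<^bsub>Qp p\<^esub> (Y \<oplus>\<^bsub>Qp p\<^esub> \<ominus>\<^bsub>Qp p\<^esub> X)"
    unfolding assms(5) using assms(1-4) by (simp add: Q.a_ac)
  also have "\<dots> = Y \<ominus>\<^bsub>Qp p\<^esub> X"
    using assms(1-4) by (simp add: a_minus_def Q.r_neg)
  finally show ?thesis .
qed

text \<open>These names can be instantiated at several primes at once, as the product ring requires.\<close>

lemmas Qp_is_cring = Q.is_cring
lemmas Qp_assoc = Q.a_assoc
lemmas Qp_comm = Q.a_comm
lemmas Qp_l_zero = Q.l_zero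
lemmas Qp_zero_closed = Q.zero_closed
lemmas Qp_one_closed = Q.one_closed
lemmas Qp_m_assoc = Q.m_assoc
lemmas Qp_l_one = Q.l_one
lemmas Qp_m_comm = Q.m_comm
lemmas Qp_l_distr = Q.l_distr
lemmas Qp_minus_equality = Q.minus_equality

end

locale prime_set =
  fixes S :: "nat set"
  assumes finite_S: "finite S" and S_nonempty: "S \<noteq> {}"
    and S_prime: "p \<in> S \<Longrightarrow> prime p"
begin

lemma padic_S: "p \<in> S \<Longrightarrow> padic p"
  by (simp add: padic_def S_prime)

lemma cring_Qp: "p \<in> S \<Longrightarrow> cring (Qp p)"
  using padic.Qp_is_cring[OF padic_S] .

lemma abelian_group_Qp: "p \<in> S \<Longrightarrow> abelian_group (Qp p)"
  using cring_Qp by (simp add: cring_def ring_def)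

lemma QS_apply:
  "p \<in> S \<Longrightarrow> (x \<oplus>\<^bsub>QS S\<^esub> y) p = x p \<oplus>\<^bsub>Qp p\<^esub> y p"
  "p \<in> S \<Longrightarrow> (x \<otimes>\<^bsub>QS S\<^esub> y) p = x p \<otimes>\<^bsub>Qp p\<^esub> y p"
  "p \<in> S \<Longrightarrow> \<zero>\<^bsub>QS S\<^esub> p = \<zero>\<^bsub>Qp p\<^esub>"
  "p \<in> S \<Longrightarrow> \<one>\<^bsub>QS S\<^esub> p = \<one>\<^bsub>Qp p\<^esub>"
  "p \<in> S \<Longrightarrow> QS_of_rat S r p = Qp_of_rat p r"
  by (simp_all add: QS_def QS_of_rat_def)

lemma QS_carrier: "x \<in> carrier (QS S) \<Longrightarrow> p \<in> S \<Longrightarrow> x p \<in> carrier (Qp p)"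
  by (auto simp: QS_def)

lemma QS_eqI:
  "x \<in> carrier (QS S) \<Longrightarrow> y \<in> carrier (QS S) \<Longrightarrow> (\<And>p. p \<in> S \<Longrightarrow> x p = y p) \<Longrightarrow> x = y"
  unfolding QS_def by (rule PiE_ext[of _ S "\<lambda>p. carrier (Qp p)"]) simp_all

lemma restrict_in_QS:
  "(\<And>p. p \<in> S \<Longrightarrow> f p \<in> carrier (Qp p)) \<Longrightarrow> (\<lambda>p\<in>S. f p) \<in> carrier (QS S)"
  by (simp add: QS_def)

lemma QS_closed:
  assumes "x \<in> carrier (QS S)" "y \<in> carrier (QS S)"
  shows "x \<oplus>\<^bsub>QS S\<^esub> y \<in> carrier (QS S)" "x \<otimes>\<^bsub>QS S\<^esub> y \<in> carrier (QS S)"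
proof -
  have "(\<lambda>p\<in>S. x p \<oplus>\<^bsub>Qp p\<^esub> y p) \<in> carrier (QS S)"
  proof (rule restrict_in_QS)
    fix p assume "p \<in> S"
    then interpret cring "Qp p" by (rule cring_Qp)
    show "x p \<oplus>\<^bsub>Qp p\<^esub> y p \<in> carrier (Qp p)" using assms QS_carrier \<open>p \<in> S\<close> by simp
  qed
  moreover have "(\<lambda>p\<in>S. x p \<otimes>\<^bsub>Qp p\<^esub> y p) \<in> carrier (QS S)"
  proof (rule restrict_in_QS)
    fix p assume "p \<in> S"
    then interpret cring "Qp p" by (rule cring_Qp)
    show "x p \<otimes>\<^bsub>Qp p\<^esub> y p \<in> carrier (Qp p)" using assms QS_carrier \<open>p \<in> S\<close> by simp
  qed
  ultimately show "x \<oplus>\<^bsub>QS S\<^esub> y \<in> carrier (QS S)" "x \<otimes>\<^bsub>QS S\<^esub> y \<in> carrier (QS S)"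
    by (simp_all add: QS_def)
qed

lemma QS_consts:
  "\<zero>\<^bsub>QS S\<^esub> \<in> carrier (QS S)" "\<one>\<^bsub>QS S\<^esub> \<in> carrier (QS S)" "QS_of_rat S r \<in> carrier (QS S)"
proof -
  have "\<zero>\<^bsub>Qp p\<^esub> \<in> carrier (Qp p)" "\<one>\<^bsub>Qp p\<^esub> \<in> carrier (Qp p)" "Qp_of_rat p r \<in> carrier (Qp p)" if "p \<in> S" for p
    using padic.Qp_zero_closed padic.Qp_one_closed padic.qrat_carrier padic_S[OF that] by auto
  thus "\<zero>\<^bsub>QS S\<^esub> \<in> carrier (QS S)" "\<one>\<^bsub>QS S\<^esub> \<in> carrier (QS S)" "QS_of_rat S r \<in> carrier (QS S)"
    by (simp_all add: QS_def QS_of_rat_def)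
qed

lemma cring_QS: "cring (QS S)"
proof (intro cringI abelian_groupI comm_monoidI)
  fix x assume x: "x \<in> carrier (QS S)"
  have y: "(\<lambda>p\<in>S. \<ominus>\<^bsub>Qp p\<^esub> x p) \<in> carrier (QS S)"
    using x QS_carrier abelian_group.a_inv_closed[OF abelian_group_Qp] by (intro restrict_in_QS) auto
  show "\<exists>y\<in>carrier (QS S). y \<oplus>\<^bsub>QS S\<^esub> x = \<zero>\<^bsub>QS S\<^esub>"
    using x y QS_carrier abelian_group.l_neg[OF abelian_group_Qp]
    by (intro bexI[OF _ y] QS_eqI QS_closed QS_consts) (auto simp: QS_apply)
next
  fix x y z assume "x \<in> carrier (QS S)" "y \<in> carrier (QS S)" "z \<in> carrier (QS S)"
  thus "x \<oplus>\<^bsub>QS S\<^esub> y \<oplus>\<^bsub>QS S\<^esub> z = x \<oplus>\<^bsub>QS S\<^esub> (y \<oplus>\<^bsub>QS S\<^esub> z)"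
    using padic.Qp_assoc[OF padic_S] QS_carrier
    by (intro QS_eqI QS_closed QS_consts) (auto simp: QS_apply)
next
  fix x y assume "x \<in> carrier (QS S)" "y \<in> carrier (QS S)"
  thus "x \<oplus>\<^bsub>QS S\<^esub> y = y \<oplus>\<^bsub>QS S\<^esub> x"
    using padic.Qp_comm[OF padic_S] QS_carrier
    by (intro QS_eqI QS_closed QS_consts) (auto simp: QS_apply)
next
  fix x assume "x \<in> carrier (QS S)"
  thus "\<zero>\<^bsub>QS S\<^esub> \<oplus>\<^bsub>QS S\<^esub> x = x"
    using padic.Qp_l_zero[OF padic_S] QS_carrier
    by (intro QS_eqI QS_closed QS_consts) (auto simp: QS_apply)
next
  fix x y z assume "x \<in> carrier (QS S)" "y \<in> carrier (QS S)" "z \<in> carrier (QS S)"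
  thus "x \<otimes>\<^bsub>QS S\<^esub> y \<otimes>\<^bsub>QS S\<^esub> z = x \<otimes>\<^bsub>QS S\<^esub> (y \<otimes>\<^bsub>QS S\<^esub> z)"
    using padic.Qp_m_assoc[OF padic_S] QS_carrier
    by (intro QS_eqI QS_closed QS_consts) (auto simp: QS_apply)
next
  fix x assume "x \<in> carrier (QS S)"
  thus "\<one>\<^bsub>QS S\<^esub> \<otimes>\<^bsub>QS S\<^esub> x = x"
    using padic.Qp_l_one[OF padic_S] QS_carrier
    by (intro QS_eqI QS_closed QS_consts) (auto simp: QS_apply)
next
  fix x y assume "x \<in> carrier (QS S)" "y \<in> carrier (QS S)"
  thus "x \<otimes>\<^bsub>QS S\<^esub> y = y \<otimes>\<^bsub>QS S\<^esub> x"
    using padic.Qp_m_comm[OF padic_S] QS_carrier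
    by (intro QS_eqI QS_closed QS_consts) (auto simp: QS_apply)
next
  fix x y z assume "x \<in> carrier (QS S)" "y \<in> carrier (QS S)" "z \<in> carrier (QS S)"
  thus "(x \<oplus>\<^bsub>QS S\<^esub> y) \<otimes>\<^bsub>QS S\<^esub> z = x \<otimes>\<^bsub>QS S\<^esub> z \<oplus>\<^bsub>QS S\<^esub> y \<otimes>\<^bsub>QS S\<^esub> z"
    using padic.Qp_l_distr[OF padic_S] QS_carrier
    by (intro QS_eqI QS_closed QS_consts) (auto simp: QS_apply)
qed (auto simp: QS_closed QS_consts)

sublocale R: cring "QS S"
  by (rule cring_QS)

lemma QS_a_inv_apply:
  assumes "x \<in> carrier (QS S)" "p \<in> S"
  shows "(\<ominus>\<^bsub>QS S\<^esub> x) p = \<ominus>\<^bsub>Qp p\<^esub> x p"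
proof -
  have "(\<ominus>\<^bsub>QS S\<^esub> x) p \<oplus>\<^bsub>Qp p\<^esub> x p = \<zero>\<^bsub>Qp p\<^esub>"
    using R.l_neg[OF assms(1)] QS_apply(1)[OF assms(2), of "\<ominus>\<^bsub>QS S\<^esub> x" x] QS_apply(3)[OF assms(2)] by simp
  thus ?thesis
    using padic.Qp_minus_equality[OF padic_S[OF assms(2)]] QS_carrier[OF _ assms(2)] assms(1)
    by (metis R.a_inv_closed)
qed

text \<open>The product of the balls of radius \<open>\<bar>r\<bar>\<^sub>p\<close> over \<open>p\<close> in \<open>S\<close>, that is \<open>r \<int>\<^sub>S\<close> if \<open>r \<noteq> 0\<close>.\<close>

definition QS_ball :: "rat \<Rightarrow> qs set" where
  "QS_ball r = {x \<in> carrier (QS S). \<forall>p\<in>S. Qp_abs p (x p) \<le> padic_abs p r}"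

lemma ball_carrier: "x \<in> QS_ball r \<Longrightarrow> x \<in> carrier (QS S)"
  by (simp add: QS_ball_def)

lemma ball_1: "QS_ball 1 = ZS S"
  using padic.pabs_1[OF padic_S]
  by (simp add: QS_ball_def ZS_def Zp_def QS_def PiE_iff set_eq_iff) blast

lemma zero_in_ball: "\<zero>\<^bsub>QS S\<^esub> \<in> QS_ball r"
proof -
  have "Qp_abs p \<zero>\<^bsub>Qp p\<^esub> \<le> padic_abs p r" if "p \<in> S" for p
    using padic.qabs_eq_0_iff[OF padic_S[OF that]] padic.Qp_zero_closed[OF padic_S[OF that]]
      padic.pabs_nonneg[OF padic_S[OF that]] by (metis)
  thus ?thesis by (simp add: QS_ball_def QS_apply QS_consts)
qed

lemma ball_add: "x \<in> QS_ball r \<Longrightarrow> y \<in> QS_ball r \<Longrightarrow> x \<oplus>\<^bsub>QS S\<^esub> y \<in> QS_ball r"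
  using padic.qabs_add[OF padic_S] QS_carrier
  by (simp add: QS_ball_def QS_apply QS_closed) (meson max.bounded_iff order_trans max.boundedI)

lemma ball_uminus: "x \<in> QS_ball r \<Longrightarrow> \<ominus>\<^bsub>QS S\<^esub> x \<in> QS_ball r"
  using padic.qabs_minus[OF padic_S] QS_carrier by (auto simp: QS_ball_def QS_a_inv_apply)

lemma ball_add_iff:
  assumes "y \<in> QS_ball r" "x \<in> carrier (QS S)"
  shows "y \<oplus>\<^bsub>QS S\<^esub> x \<in> QS_ball r \<longleftrightarrow> x \<in> QS_ball r"
proof
  assume *: "y \<oplus>\<^bsub>QS S\<^esub> x \<in> QS_ball r"
  have "\<ominus>\<^bsub>QS S\<^esub> y \<oplus>\<^bsub>QS S\<^esub> (y \<oplus>\<^bsub>QS S\<^esub> x) = x"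
    using assms ball_carrier R.r_neg1 by simp
  thus "x \<in> QS_ball r" using ball_add[OF ball_uminus[OF assms(1)] *] by simp
qed (use ball_add assms in auto)

lemma ball_mult:
  assumes "x \<in> QS_ball r" "y \<in> QS_ball s"
  shows "x \<otimes>\<^bsub>QS S\<^esub> y \<in> QS_ball (r * s)"
proof -
  have "Qp_abs p (x p \<otimes>\<^bsub>Qp p\<^esub> y p) \<le> padic_abs p (r * s)" if p: "p \<in> S" for p
  proof -
    interpret padic p using padic_S[OF p] .
    have xy: "x p \<in> carrier (Qp p)" "y p \<in> carrier (Qp p)" using assms p ball_carrier QS_carrier by auto
    show ?thesis using assms p xy
      by (auto simp: qabs_mult pabs_mult QS_ball_def intro!: mult_mono)
  qed
  thus ?thesis using assms by (simp add: QS_ball_def QS_apply QS_closed)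
qed

lemma QS_of_rat_in_ball: "QS_of_rat S r \<in> QS_ball r"
  using padic.qabs_qrat[OF padic_S] by (simp add: QS_ball_def QS_consts QS_apply)

lemma QS_of_rat_mult: "QS_of_rat S (r * s) = QS_of_rat S r \<otimes>\<^bsub>QS S\<^esub> QS_of_rat S s"
  using padic.qrat_mult[OF padic_S] by (intro QS_eqI QS_closed QS_consts) (simp add: QS_apply)

lemma QS_of_rat_1: "QS_of_rat S 1 = \<one>\<^bsub>QS S\<^esub>"
  using padic.qrat_1[OF padic_S] by (intro QS_eqI QS_consts) (simp add: QS_apply)

lemma scaled_ZS_eq_ball:
  assumes "r \<noteq> 0"
  shows "(\<lambda>z. QS_of_rat S r \<otimes>\<^bsub>QS S\<^esub> z) ` ZS S = QS_ball r"
proof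
  show "(\<lambda>z. QS_of_rat S r \<otimes>\<^bsub>QS S\<^esub> z) ` ZS S \<subseteq> QS_ball r"
    using ball_mult[OF QS_of_rat_in_ball[of r]] ball_1 by fastforce
  show "QS_ball r \<subseteq> (\<lambda>z. QS_of_rat S r \<otimes>\<^bsub>QS S\<^esub> z) ` ZS S"
  proof
    fix x assume x: "x \<in> QS_ball r"
    have "QS_of_rat S (inverse r) \<otimes>\<^bsub>QS S\<^esub> x \<in> ZS S"
      using ball_mult[OF QS_of_rat_in_ball[of "inverse r"] x] assms by (simp add: ball_1)
    moreover have "QS_of_rat S r \<otimes>\<^bsub>QS S\<^esub> QS_of_rat S (inverse r) = \<one>\<^bsub>QS S\<^esub>"
      using assms QS_of_rat_mult[of r "inverse r"] QS_of_rat_1 by simp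
    hence "x = QS_of_rat S r \<otimes>\<^bsub>QS S\<^esub> (QS_of_rat S (inverse r) \<otimes>\<^bsub>QS S\<^esub> x)"
      using ball_carrier[OF x] by (simp add: QS_consts R.m_assoc[symmetric])
    ultimately show "x \<in> (\<lambda>z. QS_of_rat S r \<otimes>\<^bsub>QS S\<^esub> z) ` ZS S" by blast
  qed
qed

lemma ball_subset_divide:
  assumes "p \<in> S"
  shows "QS_ball r \<subseteq> QS_ball (r / of_nat p)"
proof -
  have "padic_abs q r \<le> padic_abs q (r / of_nat p)" if q: "q \<in> S" for q
  proof -
    interpret padic q using padic_S[OF q] .
    have p: "p > 0" "pabs (of_nat p) > 0"
      using S_prime[OF assms] by (auto intro!: pabs_pos simp: prime_gt_0_nat)
    have "pabs (of_nat p) \<le> 1" using pabs_of_int_le_1[of "int p"] by simp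
    hence "pabs r * pabs (of_nat p) \<le> pabs r" using mult_left_mono[of _ 1 "pabs r"] by simp
    thus ?thesis using p by (simp add: pabs_divide field_simps)
  qed
  thus ?thesis by (fastforce simp: QS_ball_def intro: order_trans)
qed

text \<open>Dividing \<open>r\<close> by \<open>p\<close> enlarges the ball only in the coordinate \<open>p\<close>.  The diagonally embedded
  rationals \<open>j r / p\<close> with \<open>j < p\<close> represent the cosets: in the other coordinates they already lie in the
  smaller ball, because \<open>p\<close> is a unit there.\<close>

lemma ball_divide_cosets:
  assumes "p \<in> S" "r \<noteq> 0"
  defines "c \<equiv> \<lambda>j::nat. QS_of_rat S (of_nat j * r / of_nat p)"
  shows "QS_ball (r / of_nat p) = (\<Union>j<p. (\<lambda>x. c j \<oplus>\<^bsub>QS S\<^esub> x) ` QS_ball r)"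
    and "disjoint_family_on (\<lambda>j. (\<lambda>x. c j \<oplus>\<^bsub>QS S\<^esub> x) ` QS_ball r) {..<p}"
proof -
  interpret P: padic p using padic_S[OF assms(1)] .
  have c: "c j \<in> carrier (QS S)" for j by (simp add: c_def QS_consts)
  have c_ball: "c j \<in> QS_ball (r / of_nat p)" for j
  proof -
    have "padic_abs q (of_nat j * r / of_nat p) \<le> padic_abs q (r / of_nat p)" if q: "q \<in> S" for q
    proof -
      interpret padic q using padic_S[OF q] .
      have "pabs (of_nat j) * pabs (r / of_nat p) \<le> 1 * pabs (r / of_nat p)"
        using pabs_of_int_le_1[of "int j"] by (intro mult_right_mono) auto
      thus ?thesis by (simp add: pabs_mult[symmetric])
    qed
    thus ?thesis using padic.qabs_qrat[OF padic_S] by (simp add: c_def QS_ball_def QS_consts QS_apply)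
  qed
  have other: "padic_abs q (of_nat j * r / of_nat p) \<le> padic_abs q r"
    and other': "padic_abs q (r / of_nat p) = padic_abs q r" if q: "q \<in> S" "q \<noteq> p" for q j
  proof -
    interpret padic q using padic_S[OF q(1)] .
    have p1: "pabs (of_nat p) = 1" using pabs_other_prime[OF S_prime[OF assms(1)]] q(2) by simp
    have "pabs (of_nat j) * pabs r \<le> 1 * pabs r"
      using pabs_of_int_le_1[of "int j"] by (intro mult_right_mono) auto
    thus "pabs (of_nat j * r / of_nat p) \<le> pabs r" "pabs (r / of_nat p) = pabs r"
      by (simp_all add: pabs_divide pabs_mult p1)
  qed
  show "QS_ball (r / of_nat p) = (\<Union>j<p. (\<lambda>x. c j \<oplus>\<^bsub>QS S\<^esub> x) ` QS_ball r)"
  proof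
    show "(\<Union>j<p. (\<lambda>x. c j \<oplus>\<^bsub>QS S\<^esub> x) ` QS_ball r) \<subseteq> QS_ball (r / of_nat p)"
      using ball_add[OF c_ball] ball_subset_divide[OF assms(1)] by blast
    show "QS_ball (r / of_nat p) \<subseteq> (\<Union>j<p. (\<lambda>x. c j \<oplus>\<^bsub>QS S\<^esub> x) ` QS_ball r)"
    proof
      fix x assume x: "x \<in> QS_ball (r / of_nat p)"
      have xc: "x \<in> carrier (QS S)" using x by (rule ball_carrier)
      obtain j where j: "j < p"
        "Qp_abs p (x p \<ominus>\<^bsub>Qp p\<^esub> Qp_of_rat p (of_nat j * r / of_nat p)) \<le> padic_abs p r"
        using P.residue_approximation[OF QS_carrier[OF xc assms(1)] assms(2)] x assms(1)
        unfolding QS_ball_def by blast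
      have "(x \<ominus>\<^bsub>QS S\<^esub> c j) q = x q \<ominus>\<^bsub>Qp q\<^esub> Qp_of_rat q (of_nat j * r / of_nat p)" if "q \<in> S" for q
        using that c by (simp add: a_minus_def QS_apply QS_a_inv_apply) (simp add: c_def QS_apply)
      moreover have "Qp_abs q (x q \<ominus>\<^bsub>Qp q\<^esub> Qp_of_rat q (of_nat j * r / of_nat p)) \<le> padic_abs q r"
        if q: "q \<in> S" for q
      proof (cases "q = p")
        case False
        interpret padic q using padic_S[OF q] .
        have "qabs (x q) \<le> pabs (r / of_nat p)" using x q unfolding QS_ball_def by blast
        hence "qabs (x q) \<le> pabs r" by (simp only: other'[OF q False])
        thus ?thesis
          using qabs_diff[OF QS_carrier[OF xc q] qrat_carrier, of "of_nat j * r / of_nat p"] 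
            other[OF q False, of j] by simp
      qed (use j in simp)
      ultimately have "x \<ominus>\<^bsub>QS S\<^esub> c j \<in> QS_ball r"
        using xc c by (simp add: QS_ball_def)
      moreover have "x = c j \<oplus>\<^bsub>QS S\<^esub> (x \<ominus>\<^bsub>QS S\<^esub> c j)"
        using xc c[of j] by (simp add: a_minus_def R.a_lcomm R.r_neg)
      ultimately show "x \<in> (\<Union>j<p. (\<lambda>x. c j \<oplus>\<^bsub>QS S\<^esub> x) ` QS_ball r)" using j(1) by blast
    qed
  qed
  show "disjoint_family_on (\<lambda>j. (\<lambda>x. c j \<oplus>\<^bsub>QS S\<^esub> x) ` QS_ball r) {..<p}"
    unfolding disjoint_family_on_def
  proof (intro ballI impI)
    fix i j assume ij: "i \<in> {..<p}" "j \<in> {..<p}" "i \<noteq> j"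
    show "(\<lambda>x. c i \<oplus>\<^bsub>QS S\<^esub> x) ` QS_ball r \<inter> (\<lambda>x. c j \<oplus>\<^bsub>QS S\<^esub> x) ` QS_ball r = {}"
    proof (rule ccontr)
      assume "(\<lambda>x. c i \<oplus>\<^bsub>QS S\<^esub> x) ` QS_ball r \<inter> (\<lambda>x. c j \<oplus>\<^bsub>QS S\<^esub> x) ` QS_ball r \<noteq> {}"
      then obtain x y where xy: "x \<in> QS_ball r" "y \<in> QS_ball r" "c i \<oplus>\<^bsub>QS S\<^esub> x = c j \<oplus>\<^bsub>QS S\<^esub> y" by blast
      have xyc: "x p \<in> carrier (Qp p)" "y p \<in> carrier (Qp p)"
        using xy ball_carrier QS_carrier assms(1) by auto
      let ?q = "\<lambda>j. Qp_of_rat p (of_nat j * r / of_nat p)"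
      have "?q i \<oplus>\<^bsub>Qp p\<^esub> x p = ?q j \<oplus>\<^bsub>Qp p\<^esub> y p"
        using arg_cong[OF xy(3), of "\<lambda>z. z p"] assms(1) by (simp add: QS_apply c_def)
      hence "?q i \<ominus>\<^bsub>Qp p\<^esub> ?q j = y p \<ominus>\<^bsub>Qp p\<^esub> x p"
        using xyc by (intro P.Qp_swap_summands P.qrat_carrier)
      hence "padic_abs p (of_nat i * r / of_nat p - of_nat j * r / of_nat p)
          = Qp_abs p (y p \<ominus>\<^bsub>Qp p\<^esub> x p)"
        by (metis P.qabs_qrat P.qrat_diff)
      also have "\<dots> \<le> max (Qp_abs p (y p)) (Qp_abs p (x p))"
        by (rule P.qabs_diff[OF xyc(2,1)])
      also have "\<dots> \<le> padic_abs p r" using xy(1,2) assms(1) by (simp add: QS_ball_def)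
      finally have "padic_abs p (of_nat i * r / of_nat p - of_nat j * r / of_nat p) \<le> padic_abs p r" .
      moreover have "of_nat i * r / of_nat p - of_nat j * r / of_nat p = of_int (int i - int j) * (r / of_nat p)"
        by (simp add: algebra_simps diff_divide_distrib)
      ultimately have "padic_abs p (of_int (int i - int j)) * (real p * padic_abs p r) \<le> padic_abs p r"
        by (simp add: P.pabs_mult P.pabs_divide P.pabs_p mult_ac)
      hence "padic_abs p (of_int (int i - int j)) \<le> 1 / real p ^ 1"
        using P.pabs_pos[OF assms(2)] P.p_pos by (simp add: field_simps)
      hence "int p ^ 1 dvd int i - int j" unfolding P.pabs_of_int_le_iff .
      hence "int p dvd int i - int j" by simp
      hence "int i mod int p = int j mod int p" by (simp add: mod_eq_dvd_iff)
      thus False using ij by simp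
    qed
  qed
qed

lemma QS_char_Qp_char: "QS_char S x = (\<Prod>p\<in>S. padic.Qp_char p (x p))"
  unfolding QS_char_def by (intro prod.cong refl) (simp add: padic.Qp_char_def padic_S)

lemma QS_char_add:
  assumes "x \<in> carrier (QS S)" "y \<in> carrier (QS S)"
  shows "QS_char S (x \<oplus>\<^bsub>QS S\<^esub> y) = QS_char S x * QS_char S y"
  unfolding QS_char_Qp_char prod.distrib[symmetric]
  using padic.Qp_char_add[OF padic_S] QS_carrier assms by (intro prod.cong refl) (simp add: QS_apply)

lemma QS_char_ZS:
  assumes "x \<in> QS_ball 1"
  shows "QS_char S x = 1"
proof -
  have "x p \<in> Zp p" if "p \<in> S" for p using assms that unfolding ball_1 ZS_def by auto
  thus ?thesis unfolding QS_char_Qp_char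
    using padic.Qp_char_Zp[OF padic_S] by simp
qed

lemma norm_QS_char: "norm (QS_char S x) = 1"
  unfolding QS_char_Qp_char prod_norm[symmetric]
  using padic.norm_Qp_char[OF padic_S] by simp

lemma QS_char_uminus:
  assumes "x \<in> carrier (QS S)"
  shows "QS_char S (\<ominus>\<^bsub>QS S\<^esub> x) * QS_char S x = 1"
  using QS_char_add[of "\<ominus>\<^bsub>QS S\<^esub> x" x] assms QS_char_ZS[OF zero_in_ball] by (simp add: R.l_neg)

text \<open>One coordinate of \<open>x\<close> violates the bound defining the ball, and the local statement is applied to
  that coordinate; \<open>y\<close> is zero in all others.\<close>

lemma QS_char_detects:
  assumes "x \<in> carrier (QS S)" "x \<notin> QS_ball r" "r \<noteq> 0"
  obtains y where "y \<in> QS_ball (inverse r)" "QS_char S (x \<otimes>\<^bsub>QS S\<^esub> y) \<noteq> 1"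
proof -
  obtain p where p: "p \<in> S" "Qp_abs p (x p) > padic_abs p r"
    using assms unfolding QS_ball_def by force
  interpret padic p using padic_S[OF p(1)] .
  have "qabs (x p) > 1 / pabs (inverse r)"
    using p(2) by (simp add: pabs_inverse divide_inverse)
  then obtain Y where Y: "Y \<in> carrier (Qp p)" "qabs Y \<le> pabs (inverse r)" "Qp_char (x p \<otimes>\<^bsub>Qp p\<^esub> Y) \<noteq> 1"
    using Qp_char_detects[OF QS_carrier[OF assms(1) p(1)], of "inverse r"] assms(3) by auto
  define y where "y = (\<lambda>q\<in>S. if q = p then Y else \<zero>\<^bsub>Qp q\<^esub>)"
  have y_apply: "q \<in> S \<Longrightarrow> y q = (if q = p then Y else \<zero>\<^bsub>Qp q\<^esub>)" for q by (simp add: y_def)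
  have yc: "y \<in> carrier (QS S)" unfolding y_def
    using Y(1) padic.Qp_zero_closed[OF padic_S] by (intro restrict_in_QS) auto
  have "Qp_abs q (y q) \<le> padic_abs q (inverse r)" if q: "q \<in> S" for q
    using Y(2) zero_in_ball[of "inverse r"] q by (auto simp: y_apply QS_ball_def QS_apply)
  hence "y \<in> QS_ball (inverse r)" using yc by (simp add: QS_ball_def)
  moreover have "padic.Qp_char q ((x \<otimes>\<^bsub>QS S\<^esub> y) q) = 1" if q: "q \<in> S - {p}" for q
  proof -
    interpret q: padic q using padic_S q by blast
    have "(x \<otimes>\<^bsub>QS S\<^esub> y) q = \<zero>\<^bsub>Qp q\<^esub>"
      using q QS_carrier[OF assms(1), of q] by (simp add: QS_apply y_apply)
    moreover have "\<zero>\<^bsub>Qp q\<^esub> \<in> Zp q"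
      using q.qabs_eq_0_iff[of "\<zero>\<^bsub>Qp q\<^esub>"] by (simp add: q.Zp_iff)
    ultimately show ?thesis using q.Qp_char_Zp by simp
  qed
  hence "QS_char S (x \<otimes>\<^bsub>QS S\<^esub> y) = Qp_char ((x \<otimes>\<^bsub>QS S\<^esub> y) p)"
    unfolding QS_char_Qp_char by (simp add: prod.remove[OF finite_S p(1)])
  hence "QS_char S (x \<otimes>\<^bsub>QS S\<^esub> y) \<noteq> 1"
    using Y(3) p(1) by (simp add: QS_apply y_apply)
  ultimately show ?thesis using that by blast
qed

end

section \<open>The chain of subgroups and the norm\<close>

context prime_set
begin

lemma infinite_prime_powers:
  assumes "p \<in> S"
  shows "infinite {p ^ l | l. l \<ge> (1::nat)}"
proof -
  have "inj_on (\<lambda>l. p ^ l) {1..}"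
    using prime_gt_1_nat[OF S_prime[OF assms]] by (auto intro!: inj_onI)
  hence "infinite ((\<lambda>l. p ^ l) ` {1..})"
    using finite_imageD infinite_Ici by blast
  moreover have "{p ^ l | l. l \<ge> (1::nat)} = (\<lambda>l. p ^ l) ` {1..}" by auto
  ultimately show ?thesis by simp
qed

abbreviation prime_powers :: "nat set" where
  "prime_powers \<equiv> {p ^ l | p l. p \<in> S \<and> l \<ge> 1}"

lemma infinite_prime_powers_S: "infinite prime_powers"
proof -
  obtain p where "p \<in> S" using S_nonempty by blast
  moreover from this have "{p ^ l | l. l \<ge> (1::nat)} \<subseteq> prime_powers" by blast
  ultimately show ?thesis using infinite_prime_powers infinite_super by blast
qed

lemma p_seq_eqI:
  assumes "p \<in> S" "l \<ge> 1" "q_seq S k = p ^ l"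
  shows "p_seq S k = p"
  unfolding p_seq_def
proof (rule the_equality)
  fix q assume q: "q \<in> S \<and> (\<exists>l\<ge>1. q_seq S k = q ^ l)"
  then obtain m where "m \<ge> 1" "q ^ m = p ^ l" using assms(3) by auto
  hence "p dvd q ^ m" using assms(2) by simp
  hence "p dvd q" using S_prime[OF assms(1)] prime_dvd_power by blast
  thus "q = p" using S_prime q assms(1) primes_dvd_imp_eq by blast
qed (use assms in auto)

lemma p_seq_in_S: "p_seq S k \<in> S"
proof -
  have "q_seq S k \<in> prime_powers"
    unfolding q_seq_def by (rule enumerate_in_set[OF infinite_prime_powers_S])
  then obtain p l where "p \<in> S" "l \<ge> 1" "q_seq S k = p ^ l" by blast
  thus ?thesis using p_seq_eqI by simp
qed

text \<open>Each of the infinitely many powers of \<open>p\<close> occurs in the enumeration.  This is what makes the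
  balls grow without bound in every coordinate.\<close>

lemma p_seq_infinitely_often:
  assumes "p \<in> S"
  shows "infinite {k. k \<ge> 1 \<and> p_seq S k = p}"
proof
  assume fin: "finite {k. k \<ge> 1 \<and> p_seq S k = p}"
  have "{p ^ l | l. l \<ge> (1::nat)} \<subseteq> q_seq S ` {k. k \<ge> 1 \<and> p_seq S k = p}"
  proof clarify
    fix l :: nat assume l: "1 \<le> l"
    hence pl: "p ^ l \<in> prime_powers" using assms by blast
    obtain n where "enumerate prime_powers n = p ^ l"
      using enumerate_Ex[OF infinite_prime_powers_S pl] ..
    hence "q_seq S (Suc n) = p ^ l" by (simp add: q_seq_def)
    thus "p ^ l \<in> q_seq S ` {k. k \<ge> 1 \<and> p_seq S k = p}"
      using p_seq_eqI[OF assms l] by (intro image_eqI[of _ _ "Suc n"]) simp_all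
  qed
  thus False using infinite_prime_powers[OF assms] fin finite_subset by blast
qed

definition prime_prod :: "nat \<Rightarrow> rat" where
  "prime_prod n = (\<Prod>k=1..n. of_nat (p_seq S k))"

lemma p_seq_pos: "0 < p_seq S k"
  using p_seq_in_S S_prime prime_gt_0_nat by blast

lemma prime_prod_pos: "0 < prime_prod n"
  unfolding prime_prod_def using p_seq_pos by (intro prod_pos) auto

lemma exp_sum_ln: "exp (\<Sum>k=1..n. ln (real (p_seq S k))) = real_of_rat (prime_prod n)"
  unfolding prime_prod_def using p_seq_pos by (simp add: exp_sum of_rat_prod)

lemma
  shows exp_psi_nonneg: "n \<ge> 0 \<Longrightarrow> exp_psi S n = prime_prod (nat n)"
    and exp_psi_neg: "n \<le> 0 \<Longrightarrow> exp_psi S n = inverse (prime_prod (nat (- n)))"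
    and of_rat_exp_psi: "real_of_rat (exp_psi S n) = exp (psi S n)"
proof -
  have the: "exp_psi S n = r" if "real_of_rat r = exp (psi S n)" for n r
    unfolding exp_psi_def
  proof (rule the_equality)
    fix s assume "real_of_rat s = exp (psi S n)"
    hence "real_of_rat s = real_of_rat r" using that by simp
    thus "s = r" by simp
  qed (rule that)
  have nonneg: "exp (psi S n) = real_of_rat (prime_prod (nat n))" if "n \<ge> 0" for n
    using that unfolding psi_def by (simp only: if_True exp_sum_ln)
  have neg: "exp (psi S n) = real_of_rat (inverse (prime_prod (nat (- n))))" if "n \<le> 0" for n
  proof (cases "n = 0")
    case False
    hence "\<not> 0 \<le> n" using that by simp
    thus ?thesis unfolding psi_def by (simp only: if_False exp_minus exp_sum_ln of_rat_inverse)
  qed (simp add: psi_def prime_prod_def)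
  show "n \<ge> 0 \<Longrightarrow> exp_psi S n = prime_prod (nat n)" using nonneg the by simp
  show "n \<le> 0 \<Longrightarrow> exp_psi S n = inverse (prime_prod (nat (- n)))" using neg the by simp
  show "real_of_rat (exp_psi S n) = exp (psi S n)"
    using nonneg neg the by (metis linorder_le_cases)
qed

lemma exp_psi_pos: "0 < exp_psi S n"
  using of_rat_exp_psi[of n] by (metis exp_gt_zero zero_less_of_rat_iff)

lemma exp_psi_0: "exp_psi S 0 = 1"
  by (simp add: exp_psi_nonneg prime_prod_def)

lemma exp_psi_uminus: "exp_psi S (- n) = inverse (exp_psi S n)"
  by (cases "n \<ge> 0") (simp_all add: exp_psi_nonneg exp_psi_neg)

lemma prime_prod_Suc: "prime_prod (Suc n) = of_nat (p_seq S (Suc n)) * prime_prod n"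
  by (simp add: prime_prod_def mult.commute)

text \<open>The factor is \<open>p_seq S n\<close> for \<open>n > 0\<close>; for \<open>n \<le> 0\<close> it is \<open>p_seq S (1 - n)\<close>, because \<open>psi\<close> is odd.\<close>

lemma exp_psi_step:
  obtains p where "p \<in> S" "exp_psi S n = of_nat p * exp_psi S (n - 1)"
proof (cases "n \<ge> 1")
  case True
  define k where "k = nat (n - 1)"
  have k: "n = int (Suc k)" using True by (simp add: k_def)
  have "exp_psi S n = of_nat (p_seq S (Suc k)) * exp_psi S (n - 1)"
    by (simp add: k exp_psi_nonneg nat_add_distrib prime_prod_Suc)
  thus ?thesis using that p_seq_in_S by blast
next
  case False
  define k where "k = nat (- n)"
  have n: "n = - int k" using False by (simp add: k_def)
  have k1: "nat (- (n - 1)) = Suc k" using n by simp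
  have "exp_psi S n = of_nat (p_seq S (Suc k)) * exp_psi S (n - 1)"
    using p_seq_pos[of "Suc k"] prime_prod_pos[of k] n k1
    by (simp add: exp_psi_neg prime_prod_Suc)
  thus ?thesis using that p_seq_in_S by blast
qed

text \<open>The product contains \<open>L\<close> factors equal to \<open>p\<close> as soon as \<open>n\<close> is large enough; the remaining
  factors are integers.\<close>

lemma prime_prod_pabs_unbounded:
  assumes "p \<in> S"
  shows "\<exists>n. padic_abs p (prime_prod n) \<le> 1 / real p ^ L"
proof -
  interpret padic p using padic_S[OF assms] .
  obtain K where K: "finite K" "card K = L" "K \<subseteq> {k. k \<ge> 1 \<and> p_seq S k = p}"
    using infinite_arbitrarily_large[OF p_seq_infinitely_often[OF assms]] by blast
  obtain n where n: "K \<subseteq> {..n}" using K(1) finite_nat_set_iff_bounded_le by auto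
  have sub: "K \<subseteq> {1..n}" using n K(3) by auto
  have "prime_prod n = (\<Prod>k\<in>K. of_nat (p_seq S k)) * (\<Prod>k\<in>{1..n}-K. of_nat (p_seq S k))"
    unfolding prime_prod_def using sub by (subst prod.subset_diff[of K]) (auto simp: mult.commute)
  also have "(\<Prod>k\<in>K. of_nat (p_seq S k)) = (of_nat p ^ L :: rat)"
    using K by (subst prod.cong[OF refl, of K _ "\<lambda>_. of_nat p"]) auto
  finally have "pabs (prime_prod n) = 1 / real p ^ L * pabs (of_int (\<Prod>k\<in>{1..n}-K. int (p_seq S k)))"
    by (simp add: pabs_mult pabs_power pabs_p power_divide)
  also have "\<dots> \<le> 1 / real p ^ L * 1"
    by (intro mult_left_mono pabs_of_int_le_1) simp
  finally show ?thesis by auto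
qed

lemma QS_B_eq_ball: "QS_B S n = QS_ball (inverse (exp_psi S n))"
  unfolding QS_B_def using scaled_ZS_eq_ball exp_psi_pos[of n] by simp

lemma QS_B_eq_ball': "QS_B S (- n) = QS_ball (exp_psi S n)"
  by (simp add: QS_B_eq_ball exp_psi_uminus)

lemma QS_B_step: "QS_B S (n - 1) \<subseteq> QS_B S n"
proof -
  obtain p where p: "p \<in> S" "exp_psi S n = of_nat p * exp_psi S (n - 1)"
    using exp_psi_step by blast
  have "inverse (exp_psi S n) = inverse (exp_psi S (n - 1)) / of_nat p"
    by (simp add: p(2) field_simps)
  thus ?thesis unfolding QS_B_eq_ball using ball_subset_divide[OF p(1)] by simp
qed

lemma QS_B_mono: "m \<le> n \<Longrightarrow> QS_B S m \<subseteq> QS_B S n"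
proof (induction n rule: int_ge_induct)
  case (step i)
  thus ?case using QS_B_step[of "i + 1"] by auto
qed simp

lemma exp_psi_mono: "m \<le> n \<Longrightarrow> exp_psi S m \<le> exp_psi S n"
  and exp_psi_double: "2 * exp_psi S (n - 1) \<le> exp_psi S n"
proof -
  show dbl: "2 * exp_psi S (n - 1) \<le> exp_psi S n" for n
  proof -
    obtain p where p: "p \<in> S" "exp_psi S n = of_nat p * exp_psi S (n - 1)"
      using exp_psi_step by blast
    have "(2::rat) \<le> of_nat p" using prime_ge_2_nat[OF S_prime[OF p(1)]] by simp
    thus ?thesis using exp_psi_pos[of "n - 1"] unfolding p(2) by (intro mult_right_mono) auto
  qed
  show "m \<le> n \<Longrightarrow> exp_psi S m \<le> exp_psi S n"
  proof (induction n rule: int_ge_induct)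
    case (step i)
    thus ?case using dbl[of "i + 1"] exp_psi_pos[of i] by simp
  qed simp
qed

abbreviation rad :: "int \<Rightarrow> real" where "rad n \<equiv> exp (psi S n)"

lemma rad_double: "2 * rad (n - 1) \<le> rad n"
  using exp_psi_double[of n] unfolding of_rat_exp_psi[symmetric]
  by (metis of_rat_less_eq of_rat_mult of_rat_numeral_eq)

lemma rad_mono: "m \<le> n \<Longrightarrow> rad m \<le> rad n"
  using exp_psi_mono unfolding of_rat_exp_psi[symmetric] of_rat_less_eq .

lemma rad_uminus: "rad (- n) = inverse (rad n)"
  unfolding of_rat_exp_psi[symmetric] exp_psi_uminus of_rat_inverse ..

lemma rad_strict_mono: "m < n \<Longrightarrow> rad m < rad n"
  using rad_double[of n] rad_mono[of m "n - 1"] exp_gt_zero[of "psi S (n - 1)"] by linarith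

lemma rad_less_iff: "rad m < rad n \<longleftrightarrow> m < n"
  using rad_strict_mono rad_mono by (meson linorder_not_less)

lemma rad_le_iff: "rad m \<le> rad n \<longleftrightarrow> m \<le> n"
  using rad_less_iff by (meson linorder_not_less)

lemma rad_growth: "2 ^ k * rad n \<le> rad (n + int k)"
proof (induction k)
  case (Suc k)
  thus ?case using rad_double[of "n + int (Suc k)"] by simp
qed simp

lemma rad_step_le: "rad n \<le> real (Max S) * rad (n - 1)"
proof -
  obtain p where p: "p \<in> S" "exp_psi S n = of_nat p * exp_psi S (n - 1)"
    using exp_psi_step by blast
  hence "rad n = real p * rad (n - 1)"
    unfolding of_rat_exp_psi[symmetric] by (simp add: of_rat_mult)
  thus ?thesis using p(1) finite_S by (simp add: mult_right_mono)
qed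

text \<open>The radii tend to infinity and to zero by the doubling property, so any positive real lies
  between two consecutive ones.\<close>

lemma rad_bracket:
  assumes "u > 0"
  obtains n where "rad n \<le> u" "u < rad (n + 1)"
proof -
  obtain k where k: "u < 2 ^ k" using real_arch_pow[of 2 u] by auto
  obtain j where j: "1 / u < 2 ^ j" using real_arch_pow[of 2 "1 / u"] by auto
  have r0: "rad 0 = 1" by (simp add: psi_def)
  have up: "u < rad (int k)" using rad_growth[of k 0] k r0 by simp
  have "1 / u < rad (int j)" using rad_growth[of j 0] j r0 by simp
  hence lo: "rad (- int j) \<le> u"
    using assms unfolding rad_uminus by (simp add: field_simps)
  define m where "m = (LEAST i. u < rad (- int j + int i))"
  have "- int j \<le> int k" by simp
  hence "u < rad (- int j + int (k + j))" using up by simp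
  hence m: "u < rad (- int j + int m)" unfolding m_def by (rule LeastI)
  have "m \<noteq> 0" using m lo by (intro notI) simp
  then obtain i where i: "m = Suc i" using not0_implies_Suc by blast
  hence "rad (- int j + int i) \<le> u"
    using not_less_Least[of i "\<lambda>i. u < rad (- int j + int i)"] unfolding m_def by simp
  moreover have "u < rad (- int j + int i + 1)" using m i by (simp add: algebra_simps)
  ultimately show ?thesis using that by blast
qed

text \<open>In each of the finitely many coordinates the radii eventually exceed the absolute value of \<open>x\<close>.\<close>

lemma QS_B_exhaust:
  assumes "x \<in> carrier (QS S)"
  obtains n where "x \<in> QS_B S n"
proof -
  have "\<exists>n. \<forall>m\<ge>n. Qp_abs p (x p) \<le> padic_abs p (inverse (prime_prod m))" if p: "p \<in> S" for p
  proof -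
    interpret padic p using padic_S[OF p] .
    obtain L where L: "qabs (x p) < real p ^ L" using real_arch_pow[OF p_real_gt_1] by blast
    obtain n where n: "pabs (prime_prod n) \<le> 1 / real p ^ L"
      using prime_prod_pabs_unbounded[OF p] by blast
    have "qabs (x p) \<le> pabs (inverse (prime_prod m))" if m: "m \<ge> n" for m
    proof -
      have "prime_prod m = prime_prod n * of_int (\<Prod>k\<in>{n<..m}. int (p_seq S k))"
        unfolding prime_prod_def using prod.ub_add_nat[of 1 n "\<lambda>k. of_nat (p_seq S k) :: rat" "m - n"] m
        by (simp add: atLeastSucAtMost_greaterThanAtMost)
      hence "pabs (prime_prod m) \<le> pabs (prime_prod n)"
        using mult_left_mono[OF pabs_of_int_le_1 pabs_nonneg, of "prime_prod n" "\<Prod>k\<in>{n<..m}. int (p_seq S k)"]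
        by (simp only: pabs_mult)
      hence "pabs (prime_prod m) \<le> 1 / real p ^ L" using n by simp
      moreover have "0 < pabs (prime_prod m)" using prime_prod_pos[of m] by (intro pabs_pos) simp
      ultimately have "real p ^ L \<le> pabs (inverse (prime_prod m))"
        using p_pos unfolding pabs_inverse by (simp add: field_simps)
      thus ?thesis using L by simp
    qed
    thus ?thesis by blast
  qed
  then obtain N where N: "\<And>p m. p \<in> S \<Longrightarrow> m \<ge> N p \<Longrightarrow> Qp_abs p (x p) \<le> padic_abs p (inverse (prime_prod m))"
    by metis
  have "x \<in> QS_B S (int (Max (N ` S)))"
    unfolding QS_B_eq_ball using assms finite_S by (auto simp: QS_ball_def exp_psi_nonneg intro!: N)
  thus ?thesis using that by blast
qed

lemma QS_B_inter_zero:
  assumes "x \<in> carrier (QS S)" "x \<noteq> \<zero>\<^bsub>QS S\<^esub>"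
  obtains n where "x \<notin> QS_B S n"
proof -
  obtain p where p: "p \<in> S" "x p \<noteq> \<zero>\<^bsub>Qp p\<^esub>"
    using QS_eqI[OF assms(1) QS_consts(1)] assms(2) QS_apply(3) by metis
  interpret padic p using padic_S[OF p(1)] .
  have xp: "x p \<in> carrier (Qp p)" using assms p QS_carrier by blast
  have pos: "0 < qabs (x p)" using qabs_eq_0_iff[OF xp] qabs_nonneg[OF xp] p(2) by linarith
  obtain L where "1 / qabs (x p) < real p ^ L" using real_arch_pow[OF p_real_gt_1] by blast
  hence "1 / real p ^ L < qabs (x p)" using pos p_pos by (simp add: field_simps)
  moreover obtain n where "pabs (prime_prod n) \<le> 1 / real p ^ L"
    using prime_prod_pabs_unbounded[OF p(1)] by blast
  ultimately have "\<not> qabs (x p) \<le> pabs (exp_psi S (int n))" by (simp add: exp_psi_nonneg)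
  hence "x \<notin> QS_B S (- int n)" using p(1) unfolding QS_B_eq_ball' QS_ball_def by blast
  thus ?thesis using that by blast
qed

lemma QS_norm_shell:
  assumes "x \<in> QS_B S n - QS_B S (n - 1)"
  shows "QS_norm S x = rad n"
proof -
  have "x \<noteq> \<zero>\<^bsub>QS S\<^esub>" using assms zero_in_ball unfolding QS_B_eq_ball by blast
  moreover have "(THE n. x \<in> QS_B S n - QS_B S (n - 1)) = n"
  proof (rule the_equality)
    fix m assume m: "x \<in> QS_B S m - QS_B S (m - 1)"
    show "m = n"
    proof (rule ccontr)
      assume "m \<noteq> n"
      hence "m \<le> n - 1 \<or> n \<le> m - 1" by linarith
      thus False using QS_B_mono m assms by blast
    qed
  qed (rule assms)
  ultimately show ?thesis by (simp add: QS_norm_def)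
qed

lemma shell_exists:
  assumes "x \<in> carrier (QS S)" "x \<noteq> \<zero>\<^bsub>QS S\<^esub>"
  obtains n where "x \<in> QS_B S n - QS_B S (n - 1)"
proof -
  obtain a where a: "x \<notin> QS_B S a" using QS_B_inter_zero[OF assms] .
  obtain b where b: "x \<in> QS_B S b" using QS_B_exhaust[OF assms(1)] .
  have ab: "a < b" using a b QS_B_mono[of b a] by (meson in_mono linorder_not_less)
  define m where "m = (LEAST i. x \<in> QS_B S (a + int i))"
  have "x \<in> QS_B S (a + int (nat (b - a)))" using ab b by simp
  hence m: "x \<in> QS_B S (a + int m)" unfolding m_def by (rule LeastI)
  hence "m \<noteq> 0" using a by (intro notI) simp
  then obtain i where i: "m = Suc i" using not0_implies_Suc by blast
  hence "x \<notin> QS_B S (a + int i)"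
    using not_less_Least[of i "\<lambda>i. x \<in> QS_B S (a + int i)"] unfolding m_def by simp
  thus ?thesis using that[of "a + int m"] m i by (simp add: algebra_simps)
qed

lemma QS_norm_zero: "QS_norm S \<zero>\<^bsub>QS S\<^esub> = 0"
  by (simp add: QS_norm_def)

lemma QS_norm_nonneg: "0 \<le> QS_norm S x"
  by (simp add: QS_norm_def)

lemma mem_QS_B_iff:
  assumes "x \<in> carrier (QS S)"
  shows "x \<in> QS_B S n \<longleftrightarrow> QS_norm S x \<le> rad n"
proof (cases "x = \<zero>\<^bsub>QS S\<^esub>")
  case True
  thus ?thesis using zero_in_ball unfolding QS_B_eq_ball by (simp add: QS_norm_zero)
next
  case False
  obtain m where m: "x \<in> QS_B S m - QS_B S (m - 1)" using shell_exists[OF assms False] .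
  have "x \<in> QS_B S n \<longleftrightarrow> m \<le> n"
    using m QS_B_mono[of m n] QS_B_mono[of n "m - 1"] by (cases "m \<le> n") auto
  thus ?thesis using QS_norm_shell[OF m] rad_le_iff by simp
qed

lemma QS_norm_cong:
  assumes "x \<in> carrier (QS S)" "y \<in> carrier (QS S)"
    and "\<And>n. x \<in> QS_B S n \<longleftrightarrow> y \<in> QS_B S n"
  shows "QS_norm S x = QS_norm S y"
proof (cases "x = \<zero>\<^bsub>QS S\<^esub>")
  case True
  have "y = \<zero>\<^bsub>QS S\<^esub>"
    using shell_exists[OF assms(2)] assms(3) True zero_in_ball unfolding QS_B_eq_ball by blast
  thus ?thesis using True by simp
next
  case False
  obtain m where m: "x \<in> QS_B S m - QS_B S (m - 1)" using shell_exists[OF assms(1) False] .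
  hence "y \<in> QS_B S m - QS_B S (m - 1)" using assms(3) by blast
  thus ?thesis using m QS_norm_shell by metis
qed

end

section \<open>Two real inequalities\<close>

text \<open>The exponential beats every power: with \<open>j \<ge> 2 / a\<close>, the term of degree \<open>j\<close> in the series of
  \<open>exp (v powr a)\<close> already dominates \<open>v\<^sup>2 / j!\<close>.\<close>

lemma powr_exp_bound:
  fixes a :: real
  assumes "a > 0"
  obtains K where "K > 0" "\<And>v. v \<ge> 1 \<Longrightarrow> v * exp (- (v powr a)) \<le> K / v"
proof -
  obtain j :: nat where j: "2 / a \<le> real j" using real_arch_simple by blast
  have "v * exp (- (v powr a)) \<le> fact j / v" if v: "v \<ge> 1" for v :: real
  proof -
    have "v\<^sup>2 = v powr 2" using v by simp
    also have "\<dots> \<le> v powr (a * real j)"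
      using v j assms by (intro powr_mono) (auto simp: field_simps)
    also have "\<dots> = (v powr a) ^ j"
      using v by (simp add: powr_powr[symmetric] powr_realpow)
    also have "\<dots> \<le> fact j * exp (v powr a)"
    proof -
      have "(\<Sum>n\<in>{j}. inverse (fact n) *\<^sub>R (v powr a) ^ n) \<le> exp (v powr a)"
        unfolding exp_def by (intro sum_le_suminf summable_exp_generic) auto
      thus ?thesis by (simp add: field_simps)
    qed
    finally show ?thesis using v by (simp add: exp_minus field_simps power2_eq_square)
  qed
  thus ?thesis using that[of "fact j"] by simp
qed

text \<open>Put \<open>u = t powr (1 / a)\<close>.  The larger of \<open>u\<close> and \<open>w\<close> is at least \<open>(u + w) / 2\<close>; use the bound
  that involves it.  The first bound has the same shape as the second, because
  \<open>t powr (- 1 / a) = t * u powr (- a - 1)\<close>.\<close>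

lemma min_bound_combined:
  fixes u w t a :: real
  assumes "t > 0" "a > 0" "w \<ge> 0" "A > 0" "B > 0"
    and "z \<le> A * t powr (- 1 / a)" and "w > 0 \<Longrightarrow> z \<le> B * t * w powr (- a - 1)"
  shows "z \<le> 2 powr (a + 1) * (A + B) * t * (t powr (1 / a) + w) powr (- a - 1)"
proof -
  let ?u = "t powr (1 / a)"
  have u: "?u > 0" using assms by simp
  have half: "m powr (- a - 1) \<le> 2 powr (a + 1) * (?u + w) powr (- a - 1)" if m: "m > 0" "?u + w \<le> 2 * m" for m
  proof -
    have "2 powr (- a - 1) * m powr (- a - 1) = (2 * m) powr (- a - 1)"
      using m by (simp add: powr_mult)
    also have "\<dots> \<le> (?u + w) powr (- a - 1)"
      using m add_pos_nonneg[OF u assms(3)] assms(2) by (intro powr_mono2') auto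
    finally have "2 powr (a + 1) * (2 powr (- a - 1) * m powr (- a - 1)) \<le> 2 powr (a + 1) * (?u + w) powr (- a - 1)"
      by (intro mult_left_mono) auto
    moreover have "2 powr (a + 1) * 2 powr (- a - 1) = (1::real)"
      by (simp add: powr_add[symmetric])
    ultimately show ?thesis by (simp add: mult.assoc[symmetric])
  qed
  show ?thesis
  proof (cases "?u \<le> w")
    case True
    hence w: "w > 0" using u by linarith
    have "z \<le> B * t * w powr (- a - 1)" using assms(7)[OF w] .
    also have "\<dots> \<le> (A + B) * t * (2 powr (a + 1) * (?u + w) powr (- a - 1))"
      using half[OF w] True assms by (intro mult_mono) auto
    finally show ?thesis by (simp add: mult_ac)
  next
    case False
    have "t powr (- 1 / a) = t powr (1 + 1 / a * (- a - 1))"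
      using assms(2) by (simp add: field_simps)
    also have "\<dots> = t * ?u powr (- a - 1)"
      using assms(1) by (simp only: powr_add powr_powr) simp
    finally have "z \<le> A * t * ?u powr (- a - 1)" using assms(6) by (simp add: mult_ac)
    also have "\<dots> \<le> (A + B) * t * (2 powr (a + 1) * (?u + w) powr (- a - 1))"
      using half[OF u] False assms by (intro mult_mono) auto
    finally show ?thesis by (simp add: mult_ac)
  qed
qed

section \<open>Invariant integration and the measure of balls\<close>

locale haar_measure = prime_set +
  fixes \<mu> :: "qs measure"
  assumes haar: "QS_haar S \<mu>"
begin

lemma space_haar: "space \<mu> = carrier (QS S)"
  and emeasure_translate: "a \<in> carrier (QS S) \<Longrightarrow> A \<in> sets \<mu> \<Longrightarrow>
         emeasure \<mu> ((\<lambda>x. a \<oplus>\<^bsub>QS S\<^esub> x) ` A) = emeasure \<mu> A"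
  and emeasure_ZS: "emeasure \<mu> (ZS S) = 1"
  using haar unfolding QS_haar_def by blast+

lemma sets_carrier: "A \<in> sets \<mu> \<Longrightarrow> A \<subseteq> carrier (QS S)"
  using sets.sets_into_space space_haar by blast

lemma in_sets_if_emeasure: "emeasure \<mu> A \<noteq> 0 \<Longrightarrow> A \<in> sets \<mu>"
  using emeasure_notin_sets by blast

lemma ZS_sets: "ZS S \<in> sets \<mu>"
  using emeasure_ZS by (intro in_sets_if_emeasure) simp

text \<open>Sets outside the \<open>\<sigma>\<close>-algebra are assigned measure \<open>0\<close>.  Hence the invariance axiom itself shows that
  the translate of a set of nonzero measure is measurable, and a null set is the difference of the
  two sets \<open>\<int>\<^sub>S \<union> A\<close> and \<open>\<int>\<^sub>S - A\<close> of nonzero measure.\<close>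

lemma translate_sets:
  assumes a: "a \<in> carrier (QS S)" and A: "A \<in> sets \<mu>"
  shows "(\<lambda>x. a \<oplus>\<^bsub>QS S\<^esub> x) ` A \<in> sets \<mu>"
proof (cases "emeasure \<mu> A = 0")
  case False
  thus ?thesis using emeasure_translate[OF a A] by (intro in_sets_if_emeasure) simp
next
  case True
  let ?T = "\<lambda>x. a \<oplus>\<^bsub>QS S\<^esub> x"
  have inj: "inj_on ?T (carrier (QS S))"
    using a by (intro inj_onI) (metis R.r_neg1)
  have "emeasure \<mu> (ZS S - A) = 1"
    using True A ZS_sets emeasure_ZS by (simp add: emeasure_Diff_null_set null_setsI)
  hence 1: "?T ` (ZS S - A) \<in> sets \<mu>"
    using emeasure_translate[OF a, of "ZS S - A"] A ZS_sets by (intro in_sets_if_emeasure) simp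
  have "emeasure \<mu> (ZS S) \<le> emeasure \<mu> (ZS S \<union> A)"
    using A ZS_sets by (intro emeasure_mono) auto
  hence "emeasure \<mu> (ZS S \<union> A) \<noteq> 0" using emeasure_ZS by auto
  hence 2: "?T ` (ZS S \<union> A) \<in> sets \<mu>"
    using emeasure_translate[OF a, of "ZS S \<union> A"] A ZS_sets by (intro in_sets_if_emeasure) simp
  have "A = (ZS S \<union> A) - (ZS S - A)" by blast
  moreover have "?T ` ((ZS S \<union> A) - (ZS S - A)) = ?T ` (ZS S \<union> A) - ?T ` (ZS S - A)"
    using sets_carrier[OF A] sets_carrier[OF ZS_sets] by (intro inj_on_image_set_diff[OF inj]) auto
  ultimately show ?thesis using 1 2 by (metis sets.Diff)
qed

lemma translate_vimage:
  assumes a: "a \<in> carrier (QS S)" and A: "A \<subseteq> carrier (QS S)"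
  shows "(\<lambda>x. a \<oplus>\<^bsub>QS S\<^esub> x) -` A \<inter> space \<mu> = (\<lambda>x. \<ominus>\<^bsub>QS S\<^esub> a \<oplus>\<^bsub>QS S\<^esub> x) ` A"
proof (intro equalityI subsetI)
  fix x assume x: "x \<in> (\<lambda>x. a \<oplus>\<^bsub>QS S\<^esub> x) -` A \<inter> space \<mu>"
  hence "x = \<ominus>\<^bsub>QS S\<^esub> a \<oplus>\<^bsub>QS S\<^esub> (a \<oplus>\<^bsub>QS S\<^esub> x)"
    using a by (simp add: space_haar R.r_neg1)
  thus "x \<in> (\<lambda>x. \<ominus>\<^bsub>QS S\<^esub> a \<oplus>\<^bsub>QS S\<^esub> x) ` A" using x by blast
next
  fix x assume "x \<in> (\<lambda>x. \<ominus>\<^bsub>QS S\<^esub> a \<oplus>\<^bsub>QS S\<^esub> x) ` A"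
  thus "x \<in> (\<lambda>x. a \<oplus>\<^bsub>QS S\<^esub> x) -` A \<inter> space \<mu>"
    using a A by (auto simp: space_haar R.r_neg2)
qed

lemma translate_measurable:
  assumes a: "a \<in> carrier (QS S)"
  shows "(\<lambda>x. a \<oplus>\<^bsub>QS S\<^esub> x) \<in> measurable \<mu> \<mu>"
proof (rule measurableI)
  fix A assume A: "A \<in> sets \<mu>"
  show "(\<lambda>x. a \<oplus>\<^bsub>QS S\<^esub> x) -` A \<inter> space \<mu> \<in> sets \<mu>"
    unfolding translate_vimage[OF a sets_carrier[OF A]]
    using a A by (intro translate_sets) auto
qed (use a in \<open>simp add: space_haar\<close>)

lemma distr_translate:
  assumes a: "a \<in> carrier (QS S)"
  shows "distr \<mu> \<mu> (\<lambda>x. a \<oplus>\<^bsub>QS S\<^esub> x) = \<mu>"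
proof (rule measure_eqI)
  fix A assume "A \<in> sets (distr \<mu> \<mu> (\<lambda>x. a \<oplus>\<^bsub>QS S\<^esub> x))"
  hence A: "A \<in> sets \<mu>" by simp
  have "emeasure (distr \<mu> \<mu> (\<lambda>x. a \<oplus>\<^bsub>QS S\<^esub> x)) A = emeasure \<mu> ((\<lambda>x. \<ominus>\<^bsub>QS S\<^esub> a \<oplus>\<^bsub>QS S\<^esub> x) ` A)"
    by (simp only: emeasure_distr[OF translate_measurable[OF a] A]
        translate_vimage[OF a sets_carrier[OF A]])
  also have "\<dots> = emeasure \<mu> A" using a A by (intro emeasure_translate) auto
  finally show "emeasure (distr \<mu> \<mu> (\<lambda>x. a \<oplus>\<^bsub>QS S\<^esub> x)) A = emeasure \<mu> A" .
qed simp

lemma integral_translate: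
  fixes h :: "qs \<Rightarrow> complex"
  assumes "a \<in> carrier (QS S)" "h \<in> borel_measurable \<mu>"
  shows "(LINT x|\<mu>. h (a \<oplus>\<^bsub>QS S\<^esub> x)) = (LINT x|\<mu>. h x)"
  using integral_distr[OF translate_measurable[OF assms(1)] assms(2)] distr_translate[OF assms(1)]
  by simp

text \<open>The orthogonality argument for characters: the integral is invariant under the translation and
  also gets multiplied by \<open>c \<noteq> 1\<close>.\<close>

lemma integral_eq_zero_if_translate_scales:
  fixes h :: "qs \<Rightarrow> complex"
  assumes a: "a \<in> carrier (QS S)" and h: "h \<in> borel_measurable \<mu>"
    and scale: "\<And>x. x \<in> carrier (QS S) \<Longrightarrow> h (a \<oplus>\<^bsub>QS S\<^esub> x) = c * h x" and c: "c \<noteq> 1"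
  shows "(LINT x|\<mu>. h x) = 0"
proof -
  have "(LINT x|\<mu>. h x) = (LINT x|\<mu>. h (a \<oplus>\<^bsub>QS S\<^esub> x))"
    using integral_translate[OF a h] by simp
  also have "\<dots> = (LINT x|\<mu>. c * h x)"
    using scale by (intro Bochner_Integration.integral_cong) (simp_all add: space_haar)
  also have "\<dots> = c * (LINT x|\<mu>. h x)" by simp
  finally show ?thesis using c by (simp add: algebra_simps)
qed

lemma ball_divide_sets:
  assumes "p \<in> S" "r \<noteq> 0" "QS_ball r \<in> sets \<mu>"
  shows "QS_ball (r / of_nat p) \<in> sets \<mu>"
    and "emeasure \<mu> (QS_ball (r / of_nat p)) = of_nat p * emeasure \<mu> (QS_ball r)"
proof -
  let ?c = "\<lambda>j::nat. QS_of_rat S (of_nat j * r / of_nat p)"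
  let ?A = "\<lambda>j. (\<lambda>x. ?c j \<oplus>\<^bsub>QS S\<^esub> x) ` QS_ball r"
  have A: "?A j \<in> sets \<mu>" for j
    using assms(3) by (intro translate_sets QS_consts)
  have eq: "QS_ball (r / of_nat p) = (\<Union>j\<in>{..<p}. ?A j)"
    using ball_divide_cosets(1)[OF assms(1,2)] .
  show "QS_ball (r / of_nat p) \<in> sets \<mu>"
    unfolding eq using A by (intro sets.finite_UN) auto
  have "emeasure \<mu> (QS_ball (r / of_nat p)) = (\<Sum>j\<in>{..<p}. emeasure \<mu> (?A j))"
    unfolding eq using A ball_divide_cosets(2)[OF assms(1,2)]
    by (intro sum_emeasure[symmetric]) auto
  also have "\<dots> = (\<Sum>j\<in>{..<p}. emeasure \<mu> (QS_ball r))"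
    using assms(3) by (intro sum.cong refl emeasure_translate QS_consts)
  finally show "emeasure \<mu> (QS_ball (r / of_nat p)) = of_nat p * emeasure \<mu> (QS_ball r)" by simp
qed

text \<open>Induction in both directions from \<open>B\<^sub>0 = \<int>\<^sub>S\<close>: a ball consists of \<open>p\<close> translates of the preceding
  one, where \<open>p\<close> is also the quotient of the radii.\<close>

lemma emeasure_QS_B:
  assumes sets: "\<And>n. QS_B S n \<in> sets \<mu>"
  shows "emeasure \<mu> (QS_B S n) = ennreal (rad n)"
proof -
  have step: "\<exists>p>0. rad n = real p * rad (n - 1) \<and>
      emeasure \<mu> (QS_B S n) = of_nat p * emeasure \<mu> (QS_B S (n - 1))" for n
  proof -
    obtain p where p: "p \<in> S" "exp_psi S n = of_nat p * exp_psi S (n - 1)"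
      using exp_psi_step by blast
    have "inverse (exp_psi S n) = inverse (exp_psi S (n - 1)) / of_nat p"
      by (simp add: p(2) field_simps)
    moreover have "emeasure \<mu> (QS_ball (inverse (exp_psi S (n - 1)) / of_nat p))
        = of_nat p * emeasure \<mu> (QS_ball (inverse (exp_psi S (n - 1))))"
      using exp_psi_pos[of "n - 1"] sets[of "n - 1"]
      by (intro ball_divide_sets(2)[OF p(1)]) (simp_all add: QS_B_eq_ball)
    moreover have "rad n = real p * rad (n - 1)"
      unfolding of_rat_exp_psi[symmetric] p(2) by (simp add: of_rat_mult)
    ultimately show ?thesis
      using prime_gt_0_nat[OF S_prime[OF p(1)]] by (auto simp: QS_B_eq_ball)
  qed
  show ?thesis
  proof (induction n rule: int_induct[of _ 0])
    case base
    show ?case using emeasure_ZS by (simp add: QS_B_eq_ball exp_psi_0 ball_1 psi_def)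
  next
    case (step1 i)
    obtain p where "rad (i + 1) = real p * rad i"
      "emeasure \<mu> (QS_B S (i + 1)) = of_nat p * emeasure \<mu> (QS_B S i)"
      using step[of "i + 1"] by auto
    thus ?case using step1 by (simp add: ennreal_mult ennreal_of_nat_eq_real_of_nat)
  next
    case (step2 i)
    obtain p where p: "p > 0" "rad i = real p * rad (i - 1)"
      "emeasure \<mu> (QS_B S i) = of_nat p * emeasure \<mu> (QS_B S (i - 1))"
      using step[of i] by auto
    have "of_nat p * emeasure \<mu> (QS_B S (i - 1)) = of_nat p * ennreal (rad (i - 1))"
      using p step2 by (simp add: ennreal_mult ennreal_of_nat_eq_real_of_nat)
    thus ?case using p(1) by (simp add: ennreal_mult_cancel_left)
  qed
qed

end

section \<open>The heat kernel\<close>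

lemma (in prime_set) QS_norm_rad:
  assumes "x \<in> carrier (QS S)" "x \<noteq> \<zero>\<^bsub>QS S\<^esub>"
  obtains n where "QS_norm S x = rad n"
  using shell_exists[OF assms] QS_norm_shell by metis

text \<open>The Bochner integral of a function that is not integrable is \<open>0\<close>, which trivially satisfies the
  estimate; so the analysis may assume that the integrand is integrable.\<close>

locale heat_integrand = haar_measure +
  fixes \<alpha> t :: real and x :: qs
  assumes \<alpha>_pos: "\<alpha> > 0" and t_pos: "t > 0" and x_carrier: "x \<in> carrier (QS S)"
  assumes integrable: "integrable \<mu> (\<lambda>\<xi>. QS_char S (\<ominus>\<^bsub>QS S\<^esub> (x \<otimes>\<^bsub>QS S\<^esub> \<xi>)) *
                complex_of_real (exp (- t * QS_norm S \<xi> powr \<alpha>)))"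
begin

definition decay :: "real \<Rightarrow> real" where
  "decay r = exp (- t * r powr \<alpha>)"

definition weight :: "qs \<Rightarrow> real" where
  "weight \<xi> = decay (QS_norm S \<xi>)"

definition phase :: "qs \<Rightarrow> complex" where
  "phase \<xi> = QS_char S (\<ominus>\<^bsub>QS S\<^esub> (x \<otimes>\<^bsub>QS S\<^esub> \<xi>))"

lemma heat_kernel_eq: "heat_kernel S \<mu> \<alpha> x t = (LINT \<xi>|\<mu>. phase \<xi> * complex_of_real (weight \<xi>))"
  by (simp add: heat_kernel_def phase_def weight_def decay_def)

lemma integrable_phase_weight: "integrable \<mu> (\<lambda>\<xi>. phase \<xi> * complex_of_real (weight \<xi>))"
  using integrable by (simp add: phase_def weight_def decay_def)

lemma weight_pos: "0 < weight \<xi>"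
  by (simp add: weight_def decay_def)

lemma decay_le_1: "decay r \<le> 1"
  using t_pos by (simp add: decay_def)

lemma weight_le_1: "weight \<xi> \<le> 1"
  by (simp add: weight_def decay_le_1)

lemma decay_antimono_iff: "0 \<le> r \<Longrightarrow> 0 \<le> s \<Longrightarrow> decay s \<le> decay r \<longleftrightarrow> r \<le> s"
  using t_pos \<alpha>_pos powr_less_mono2[of \<alpha>] powr_mono2[of \<alpha>]
  by (auto simp: decay_def not_le[symmetric])

lemma norm_phase: "norm (phase \<xi>) = 1"
  by (simp add: phase_def norm_QS_char)

lemma integrable_weight: "integrable \<mu> weight"
proof -
  have "integrable \<mu> (\<lambda>\<xi>. norm (phase \<xi> * complex_of_real (weight \<xi>)))"
    using integrable_phase_weight by (rule integrable_norm)
  moreover have "norm (phase \<xi> * complex_of_real (weight \<xi>)) = weight \<xi>" for \<xi>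
    using weight_pos[of \<xi>] by (simp add: norm_mult norm_phase)
  ultimately show ?thesis by simp
qed

lemma weight_measurable [measurable]: "weight \<in> borel_measurable \<mu>"
  using integrable_weight by simp

text \<open>The integrand and its absolute value \<open>weight\<close> are measurable, hence so is their quotient.\<close>

lemma phase_measurable [measurable]: "phase \<in> borel_measurable \<mu>"
proof -
  have "(\<lambda>\<xi>. (phase \<xi> * complex_of_real (weight \<xi>)) / complex_of_real (weight \<xi>)) \<in> borel_measurable \<mu>"
    using borel_measurable_integrable[OF integrable_phase_weight] by measurable
  moreover have "(phase \<xi> * complex_of_real (weight \<xi>)) / complex_of_real (weight \<xi>) = phase \<xi>" for \<xi>
    using weight_pos[of \<xi>] by simp
  ultimately show ?thesis by simp
qed

lemma QS_B_carrier: "\<xi> \<in> QS_B S n \<Longrightarrow> \<xi> \<in> carrier (QS S)"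
  unfolding QS_B_eq_ball by (rule ball_carrier)

text \<open>The weight is a strictly decreasing function of the norm, so the balls are its superlevel sets.\<close>

lemma QS_B_sets [measurable]: "QS_B S n \<in> sets \<mu>"
proof -
  have "QS_B S n = {\<xi> \<in> space \<mu>. decay (rad n) \<le> weight \<xi>}"
    using mem_QS_B_iff QS_B_carrier decay_antimono_iff QS_norm_nonneg
    unfolding space_haar weight_def by auto
  thus ?thesis by simp
qed

lemma emeasure_B: "emeasure \<mu> (QS_B S n) = ennreal (rad n)"
  by (rule emeasure_QS_B[OF QS_B_sets])

lemma measure_B: "measure \<mu> (QS_B S n) = rad n"
  by (simp add: measure_def emeasure_B)

lemma integrable_indicator_B [simp]:
  "integrable \<mu> (\<lambda>\<xi>. indicator (QS_B S n) \<xi> :: real)"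
  using emeasure_B by (intro integrable_real_indicator) auto

text \<open>A single term dominates: the one for \<open>B\<^sub>N\<close> itself if \<open>\<xi>\<close> lies in it, and otherwise the one for the shell
  containing \<open>\<xi>\<close>, where the weight equals the coefficient.\<close>

lemma weight_le_sum:
  assumes "\<xi> \<in> space \<mu>"
  shows "ennreal (weight \<xi>) \<le>
    (\<Sum>k. ennreal (if k = 0 then 1 else decay (rad (N + int k))) * indicator (QS_B S (N + int k)) \<xi>)"
    (is "_ \<le> (\<Sum>k. ?f k)")
proof -
  have xc: "\<xi> \<in> carrier (QS S)" using assms space_haar by simp
  have "F k \<le> suminf F" for F :: "nat \<Rightarrow> ennreal" and k
    using sum_le_suminf[of F "{k}"] by (simp add: summableI)
  note single = this[of ?f]
  show ?thesis
  proof (cases "\<xi> \<in> QS_B S N")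
    case True
    hence "ennreal (weight \<xi>) \<le> ?f 0" using decay_le_1 by (simp add: weight_def)
    thus ?thesis using single[of 0] by (rule order_trans)
  next
    case False
    hence "\<xi> \<noteq> \<zero>\<^bsub>QS S\<^esub>" using zero_in_ball unfolding QS_B_eq_ball by blast
    then obtain n where n: "QS_norm S \<xi> = rad n" using QS_norm_rad[OF xc] by blast
    hence "N < n" using False unfolding mem_QS_B_iff[OF xc] n rad_le_iff by simp
    define k where "k = nat (n - N)"
    have k: "k \<noteq> 0" "N + int k = n" using \<open>N < n\<close> by (auto simp: k_def)
    have "\<xi> \<in> QS_B S n" using n xc by (simp add: mem_QS_B_iff)
    hence "ennreal (weight \<xi>) \<le> ?f k" using k n by (simp add: weight_def)
    thus ?thesis using single[of k] by (rule order_trans)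
  qed
qed

lemma integral_weight_le:
  assumes K: "K > 0" "\<And>v. v \<ge> 1 \<Longrightarrow> v * exp (- (v powr \<alpha>)) \<le> K / v"
  shows "(LINT \<xi>|\<mu>. weight \<xi>) \<le> 2 * (1 + 2 * K) * t powr (- 1 / \<alpha>)"
proof -
  define u where "u = t powr (- 1 / \<alpha>)"
  have u: "u > 0" using t_pos by (simp add: u_def)
  have "u powr \<alpha> = t powr (- 1)"
    unfolding u_def powr_powr using \<alpha>_pos by simp
  hence tu: "t * u powr \<alpha> = 1" using t_pos by (simp add: powr_minus)
  obtain N where N: "rad N \<le> u" "u < rad (N + 1)" using rad_bracket[OF u] .
  define a where "a k = (if k = 0 then 1 else decay (rad (N + int k)))" for k :: nat
  have a_nonneg: "0 \<le> a k" for k by (simp add: a_def decay_def)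
  have term_le: "a k * rad (N + int k) \<le> u * (1 + 2 * K) * (1 / 2) ^ k" for k
  proof (cases k)
    case 0
    have "u * 1 \<le> u * (1 + 2 * K)"
      using u K(1) by (intro mult_left_mono) auto
    hence "rad N \<le> u * (1 + 2 * K)" using N(1) by linarith
    thus ?thesis using 0 by (simp add: a_def)
  next
    case (Suc i)
    \<comment> \<open>In units of \<open>u\<close> the radius is \<open>v \<ge> 2 ^ (k - 1)\<close>, and the term becomes \<open>u v exp (- v\<^sup>\<alpha>)\<close>.\<close>
    define v where "v = rad (N + int k) / u"
    have "2 ^ i * u \<le> 2 ^ i * rad (N + 1)" using N(2) by simp
    also have "\<dots> \<le> rad (N + 1 + int i)" by (rule rad_growth)
    also have "N + 1 + int i = N + int k" using Suc by simp
    finally have "2 ^ i * u \<le> rad (N + int k)" .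
    hence v: "2 ^ i \<le> v" using u by (simp add: v_def field_simps)
    have v1: "1 \<le> v" using v one_le_power[of "2::real" i] by linarith
    have rad_v: "rad (N + int k) = u * v" using u by (simp add: v_def)
    have "t * rad (N + int k) powr \<alpha> = t * u powr \<alpha> * v powr \<alpha>"
      using u v1 by (simp add: rad_v powr_mult)
    hence "a k = exp (- (v powr \<alpha>))" using Suc tu by (simp add: a_def decay_def)
    hence "a k * rad (N + int k) = u * (v * exp (- (v powr \<alpha>)))" by (simp add: rad_v)
    also have "\<dots> \<le> u * (K / v)" using K(2)[OF v1] u by (intro mult_left_mono) auto
    also have "\<dots> \<le> u * (K / 2 ^ i)"
      using u K(1) v v1 by (intro mult_left_mono divide_left_mono) auto
    also have "\<dots> = u * (2 * K) * (1 / 2) ^ k" by (simp add: Suc power_divide)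
    also have "\<dots> \<le> u * (1 + 2 * K) * (1 / 2) ^ k"
      using u by (intro mult_right_mono mult_left_mono) auto
    finally show ?thesis .
  qed
  have "ennreal (LINT \<xi>|\<mu>. weight \<xi>) = (\<integral>\<^sup>+\<xi>. ennreal (weight \<xi>) \<partial>\<mu>)"
    using nn_integral_eq_integral[OF integrable_weight] weight_pos by (simp add: less_imp_le)
  also have "\<dots> \<le> (\<integral>\<^sup>+\<xi>. (\<Sum>k. ennreal (a k) * indicator (QS_B S (N + int k)) \<xi>) \<partial>\<mu>)"
    unfolding a_def by (intro nn_integral_mono weight_le_sum)
  also have "\<dots> = (\<Sum>k. \<integral>\<^sup>+\<xi>. ennreal (a k) * indicator (QS_B S (N + int k)) \<xi> \<partial>\<mu>)"
    by (intro nn_integral_suminf) simp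
  also have "\<dots> = (\<Sum>k. ennreal (a k * rad (N + int k)))"
    using a_nonneg by (simp add: nn_integral_cmult_indicator emeasure_B ennreal_mult)
  also have "\<dots> \<le> (\<Sum>k. ennreal (u * (1 + 2 * K) * (1 / 2) ^ k))"
    using term_le by (intro suminf_le ennreal_leI summableI)
  also have "\<dots> = ennreal (\<Sum>k. u * (1 + 2 * K) * (1 / 2) ^ k)"
    using u K(1) by (intro suminf_ennreal2 summable_mult summable_geometric) auto
  also have "(\<Sum>k. u * (1 + 2 * K) * (1 / 2) ^ k) = u * (1 + 2 * K) * 2"
    by (subst suminf_mult) (simp_all add: suminf_geometric)
  finally have "(LINT \<xi>|\<mu>. weight \<xi>) \<le> u * (1 + 2 * K) * 2"
    using u K(1) by (subst (asm) ennreal_le_iff) auto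
  thus ?thesis unfolding u_def by (simp only: mult_ac)
qed

lemma norm_heat_kernel_le: "norm (heat_kernel S \<mu> \<alpha> x t) \<le> (LINT \<xi>|\<mu>. weight \<xi>)"
proof -
  have "norm (heat_kernel S \<mu> \<alpha> x t) \<le> (LINT \<xi>|\<mu>. norm (phase \<xi> * complex_of_real (weight \<xi>)))"
    unfolding heat_kernel_eq by (rule integral_norm_bound)
  also have "\<dots> = (LINT \<xi>|\<mu>. weight \<xi>)"
    using weight_pos by (intro Bochner_Integration.integral_cong) (simp_all add: norm_mult norm_phase less_imp_le)
  finally show ?thesis .
qed

lemma phase_add:
  assumes "\<xi> \<in> carrier (QS S)" "\<eta> \<in> carrier (QS S)"
  shows "phase (\<xi> \<oplus>\<^bsub>QS S\<^esub> \<eta>) = phase \<xi> * phase \<eta>"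
  unfolding phase_def using assms x_carrier
  by (simp add: R.r_distr R.minus_add QS_char_add)

lemma heat_kernel_zero:
  assumes "x = \<zero>\<^bsub>QS S\<^esub>"
  shows "heat_kernel S \<mu> \<alpha> x t = complex_of_real (LINT \<xi>|\<mu>. weight \<xi>)"
proof -
  have "phase \<xi> = 1" if "\<xi> \<in> space \<mu>" for \<xi>
  proof -
    have "x \<otimes>\<^bsub>QS S\<^esub> \<xi> = \<zero>\<^bsub>QS S\<^esub>" using that assms by (simp add: space_haar)
    thus ?thesis using QS_char_ZS[OF zero_in_ball] by (simp add: phase_def)
  qed
  hence "heat_kernel S \<mu> \<alpha> x t = (LINT \<xi>|\<mu>. complex_of_real (weight \<xi>))"
    unfolding heat_kernel_eq by (intro Bochner_Integration.integral_cong) simp_all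
  thus ?thesis by simp
qed

text \<open>This is the cancellation described at the beginning, for \<open>\<parallel>x\<parallel> = r\<^sub>m\<close>.  The integrand is split as
  \<open>f1 + f3 + c f2\<close>, where \<open>f1\<close> is its part outside the ball \<open>A\<close>, \<open>f2\<close> is the character on \<open>A\<close>, and
  \<open>f3 = g - c\<close> on \<open>D\<close>; the integrals of \<open>f1\<close> and \<open>f2\<close> vanish.\<close>

lemma heat_kernel_nonzero:
  assumes m: "QS_norm S x = rad m"
  shows "heat_kernel S \<mu> \<alpha> x t =
    complex_of_real (LINT \<xi>|\<mu>. indicator (QS_B S (- m)) \<xi> * (weight \<xi> - decay (rad (1 - m))))"
proof -
  define A where "A = QS_B S (1 - m)"
  define D where "D = QS_B S (- m)"
  define c where "c = decay (rad (1 - m))"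
  have A_sets [measurable]: "A \<in> sets \<mu>" and D_sets [measurable]: "D \<in> sets \<mu>"
    by (simp_all add: A_def D_def)
  have DA: "D \<subseteq> A" unfolding A_def D_def by (intro QS_B_mono) simp
  \<comment> \<open>The balls \<open>B\<^sub>m\<close> and \<open>B\<^sub>-\<^sub>m\<close> multiply into \<open>\<int>\<^sub>S\<close>.\<close>
  have phase_D: "phase \<xi> = 1" if "\<xi> \<in> D" for \<xi>
  proof -
    have "x \<in> QS_ball (inverse (exp_psi S m))"
      using m x_carrier unfolding QS_B_eq_ball[symmetric] by (simp add: mem_QS_B_iff)
    moreover have "\<xi> \<in> QS_ball (exp_psi S m)"
      using that unfolding D_def QS_B_eq_ball' .
    ultimately have "x \<otimes>\<^bsub>QS S\<^esub> \<xi> \<in> QS_ball (inverse (exp_psi S m) * exp_psi S m)"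
      by (rule ball_mult)
    hence "x \<otimes>\<^bsub>QS S\<^esub> \<xi> \<in> QS_ball 1" using exp_psi_pos[of m] by simp
    thus ?thesis unfolding phase_def by (intro QS_char_ZS ball_uminus)
  qed
  obtain y where y: "y \<in> A" "phase y \<noteq> 1"
  proof -
    have "x \<notin> QS_ball (inverse (exp_psi S (m - 1)))"
      using m x_carrier rad_less_iff[of "m - 1" m]
      unfolding QS_B_eq_ball[symmetric] by (simp add: mem_QS_B_iff not_le)
    then obtain y where y: "y \<in> QS_ball (exp_psi S (m - 1))" "QS_char S (x \<otimes>\<^bsub>QS S\<^esub> y) \<noteq> 1"
      using QS_char_detects[OF x_carrier] exp_psi_pos[of "m - 1"] by force
    have "phase y * QS_char S (x \<otimes>\<^bsub>QS S\<^esub> y) = 1"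
      unfolding phase_def using QS_char_uminus x_carrier ball_carrier[OF y(1)] by simp
    hence "phase y \<noteq> 1" using y(2) by auto
    moreover have "y \<in> A" using y(1) unfolding A_def QS_B_eq_ball'[symmetric] by simp
    ultimately show ?thesis using that by blast
  qed
  have yc: "y \<in> carrier (QS S)" using y(1) QS_B_carrier unfolding A_def by blast
  have shift_A: "y \<oplus>\<^bsub>QS S\<^esub> \<xi> \<in> A \<longleftrightarrow> \<xi> \<in> A" if "\<xi> \<in> carrier (QS S)" for \<xi>
    using ball_add_iff y(1) that unfolding A_def QS_B_eq_ball by blast
  have weight_shift: "weight (y \<oplus>\<^bsub>QS S\<^esub> \<xi>) = weight \<xi>" if xi: "\<xi> \<in> carrier (QS S)" "\<xi> \<notin> A" for \<xi>
  proof -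
    \<comment> \<open>A ball of the chain contains \<open>y\<close> or is contained in \<open>A\<close>, and \<open>A\<close> contains neither of the two points.\<close>
    have "y \<oplus>\<^bsub>QS S\<^esub> \<xi> \<in> QS_B S n \<longleftrightarrow> \<xi> \<in> QS_B S n" for n
    proof (cases "n \<le> 1 - m")
      case True
      hence "QS_B S n \<subseteq> A" unfolding A_def by (rule QS_B_mono)
      thus ?thesis using xi shift_A[OF xi(1)] by blast
    next
      case False
      hence "A \<subseteq> QS_B S n" unfolding A_def by (intro QS_B_mono) simp
      hence "y \<in> QS_B S n" using y(1) by blast
      thus ?thesis using ball_add_iff xi(1) unfolding QS_B_eq_ball by blast
    qed
    hence "QS_norm S (y \<oplus>\<^bsub>QS S\<^esub> \<xi>) = QS_norm S \<xi>"
      using yc xi(1) by (intro QS_norm_cong) auto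
    thus ?thesis by (simp add: weight_def)
  qed
  let ?f = "\<lambda>\<xi>. phase \<xi> * complex_of_real (weight \<xi>)"
  define f1 where "f1 \<xi> = (1 - indicator A \<xi>) * ?f \<xi>" for \<xi>
  define f2 where "f2 \<xi> = indicator A \<xi> * phase \<xi>" for \<xi>
  define f3 where "f3 \<xi> = indicator D \<xi> * (weight \<xi> - c)" for \<xi>
  have f1_meas: "f1 \<in> borel_measurable \<mu>" and f2_meas: "f2 \<in> borel_measurable \<mu>"
    and f3_meas: "f3 \<in> borel_measurable \<mu>"
    unfolding f1_def f2_def f3_def by measurable
  have ind: "integrable \<mu> (\<lambda>\<xi>. indicator A \<xi> :: real)" "integrable \<mu> (\<lambda>\<xi>. indicator D \<xi> :: real)"
    unfolding A_def D_def by simp_all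
  have f1_int: "integrable \<mu> f1"
    using integrable_phase_weight f1_meas
    by (rule Bochner_Integration.integrable_bound) (simp add: f1_def norm_mult split: split_indicator)
  have f2_int: "integrable \<mu> f2"
    using ind(1) f2_meas
    by (rule Bochner_Integration.integrable_bound)
       (simp add: f2_def norm_mult norm_phase split: split_indicator)
  have c01: "0 < c" "c \<le> 1" by (simp_all add: c_def decay_le_1) (simp add: decay_def)
  have "norm (f3 \<xi>) \<le> norm (indicator D \<xi> :: real)" for \<xi>
    using weight_pos[of \<xi>] weight_le_1[of \<xi>] c01
    by (auto simp: f3_def split: split_indicator)
  hence f3_int: "integrable \<mu> f3"
    by (intro Bochner_Integration.integrable_bound[OF ind(2) f3_meas]) simp
  have f1_zero: "(LINT \<xi>|\<mu>. f1 \<xi>) = 0"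
  proof (rule integral_eq_zero_if_translate_scales[OF yc f1_meas _ y(2)])
    fix \<xi> assume xi: "\<xi> \<in> carrier (QS S)"
    show "f1 (y \<oplus>\<^bsub>QS S\<^esub> \<xi>) = phase y * f1 \<xi>"
      using shift_A[OF xi] weight_shift[OF xi] phase_add[OF yc xi]
      by (cases "\<xi> \<in> A") (simp_all add: f1_def)
  qed
  have f2_zero: "(LINT \<xi>|\<mu>. f2 \<xi>) = 0"
  proof (rule integral_eq_zero_if_translate_scales[OF yc f2_meas _ y(2)])
    fix \<xi> assume xi: "\<xi> \<in> carrier (QS S)"
    show "f2 (y \<oplus>\<^bsub>QS S\<^esub> \<xi>) = phase y * f2 \<xi>"
      using shift_A[OF xi] phase_add[OF yc xi] by (simp add: f2_def indicator_def)
  qed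
  have decomp: "?f \<xi> = f1 \<xi> + (complex_of_real (f3 \<xi>) + complex_of_real c * f2 \<xi>)"
    if "\<xi> \<in> space \<mu>" for \<xi>
  proof -
    have xi: "\<xi> \<in> carrier (QS S)" using that by (simp add: space_haar)
    consider "\<xi> \<notin> A" | "\<xi> \<in> D" | "\<xi> \<in> A" "\<xi> \<notin> D" by blast
    thus ?thesis
    proof cases
      case 1
      moreover have "\<xi> \<notin> D" using 1 DA by blast
      ultimately show ?thesis by (simp add: f1_def f2_def f3_def)
    next
      case 2
      thus ?thesis using DA phase_D[OF 2] by (auto simp: f1_def f2_def f3_def)
    next
      case 3
      \<comment> \<open>Here \<open>\<xi>\<close> lies on a single shell, so the weight is the constant \<open>c\<close>.\<close>
      have "\<xi> \<in> QS_B S (1 - m) - QS_B S (1 - m - 1)" using 3 by (simp add: A_def D_def)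
      hence "weight \<xi> = c" unfolding weight_def c_def by (simp only: QS_norm_shell)
      thus ?thesis using 3 by (simp add: f1_def f2_def f3_def mult.commute)
    qed
  qed
  have "heat_kernel S \<mu> \<alpha> x t = (LINT \<xi>|\<mu>. f1 \<xi> + (complex_of_real (f3 \<xi>) + complex_of_real c * f2 \<xi>))"
    unfolding heat_kernel_eq using decomp by (intro Bochner_Integration.integral_cong) simp_all
  also have "\<dots> = (LINT \<xi>|\<mu>. f1 \<xi>) + ((LINT \<xi>|\<mu>. complex_of_real (f3 \<xi>)) + complex_of_real c * (LINT \<xi>|\<mu>. f2 \<xi>))"
    using f1_int f2_int f3_int by simp
  also have "\<dots> = complex_of_real (LINT \<xi>|\<mu>. f3 \<xi>)"
    using f1_zero f2_zero by simp
  finally have "heat_kernel S \<mu> \<alpha> x t = complex_of_real (LINT \<xi>|\<mu>. f3 \<xi>)" .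
  thus ?thesis by (simp add: f3_def D_def c_def)
qed

lemma heat_kernel_real: "heat_kernel S \<mu> \<alpha> x t \<in> \<real>"
proof (cases "x = \<zero>\<^bsub>QS S\<^esub>")
  case True
  show ?thesis unfolding heat_kernel_zero[OF True] by (rule Reals_of_real)
next
  case False
  then obtain m where "QS_norm S x = rad m" using QS_norm_rad[OF x_carrier] by blast
  thus ?thesis by (simp only: heat_kernel_nonzero Reals_of_real)
qed

text \<open>On \<open>D\<close> the integrand \<open>g - c\<close> is at most \<open>1 - c \<le> t r\<^sup>\<alpha>\<close> with \<open>r\<close> the radius of the next larger ball,
  and \<open>D\<close> has measure \<open>1 / \<parallel>x\<parallel>\<close>.\<close>

lemma heat_kernel_off_diagonal:
  assumes "x \<noteq> \<zero>\<^bsub>QS S\<^esub>"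
  shows "Re (heat_kernel S \<mu> \<alpha> x t) \<le> real (Max S) powr \<alpha> * t * QS_norm S x powr (- \<alpha> - 1)"
proof -
  obtain m where m: "QS_norm S x = rad m" using QS_norm_rad[OF x_carrier assms] by blast
  define M where "M = real (Max S)"
  have M0: "M \<ge> 0" by (simp add: M_def)
  let ?g = "\<lambda>\<xi>. indicator (QS_B S (- m)) \<xi> * (weight \<xi> - decay (rad (1 - m)))"
  let ?h = "\<lambda>\<xi>. indicator (QS_B S (- m)) \<xi> * (t * rad (1 - m) powr \<alpha>)"
  have 1: "?g \<xi> \<le> ?h \<xi>" for \<xi>
  proof -
    have "1 - t * rad (1 - m) powr \<alpha> \<le> decay (rad (1 - m))"
      using exp_ge_add_one_self[of "- t * rad (1 - m) powr \<alpha>"] by (simp add: decay_def)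
    hence "weight \<xi> - decay (rad (1 - m)) \<le> t * rad (1 - m) powr \<alpha>"
      using decay_le_1[of "QS_norm S \<xi>"] by (simp add: weight_def)
    thus ?thesis by (intro mult_left_mono) auto
  qed
  have "Re (heat_kernel S \<mu> \<alpha> x t) = (LINT \<xi>|\<mu>. ?g \<xi>)"
    by (simp only: heat_kernel_nonzero[OF m] Re_complex_of_real)
  also have "\<dots> \<le> (LINT \<xi>|\<mu>. ?h \<xi>)"
  proof (rule integral_mono')
    show "integrable \<mu> ?h" by (intro integrable_mult_left integrable_indicator_B)
    show "0 \<le> ?h \<xi>" for \<xi> using t_pos by simp
  qed (rule 1)
  also have "\<dots> = rad (- m) * (t * rad (1 - m) powr \<alpha>)"
    using QS_B_sets[of "- m"] sets_carrier by (simp add: measure_B space_haar Int_absorb2)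
  also have "\<dots> \<le> rad (- m) * (t * (M * rad (- m)) powr \<alpha>)"
    using rad_step_le[of "1 - m"] t_pos \<alpha>_pos unfolding M_def
    by (intro mult_left_mono powr_mono2) auto
  also have "\<dots> = M powr \<alpha> * t * (rad (- m) powr 1 * rad (- m) powr \<alpha>)"
    using M0 by (simp add: powr_mult mult_ac)
  also have "rad (- m) powr 1 * rad (- m) powr \<alpha> = rad m powr (- \<alpha> - 1)"
    unfolding powr_add[symmetric] rad_uminus by (simp add: powr_def ln_inverse algebra_simps exp_minus[symmetric])
  finally show ?thesis by (simp only: m M_def)
qed

end

theorem proposition4p6:
  fixes S :: "nat set" and \<mu> :: "qs measure" and \<alpha> :: real
  assumes "finite S" and "S \<noteq> {}" and "\<And>p. p \<in> S \<Longrightarrow> prime p"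
    and "QS_haar S \<mu>"
    and "\<alpha> > 0"
  shows "\<exists>C>0. \<forall>x\<in>carrier (QS S). \<forall>t>0.
           heat_kernel S \<mu> \<alpha> x t \<in> \<real> \<and>
           Re (heat_kernel S \<mu> \<alpha> x t)
             \<le> C * t * (t powr (1 / \<alpha>) + QS_norm S x) powr (- \<alpha> - 1)"
proof -
  interpret haar_measure S \<mu>
    by unfold_locales (use assms in auto)
  obtain K where K: "K > 0" "\<And>v. v \<ge> 1 \<Longrightarrow> v * exp (- (v powr \<alpha>)) \<le> K / v"
    using powr_exp_bound[OF assms(5)] by blast
  \<comment> \<open>\<open>A\<close> is the constant of the bound that is good for small \<open>\<parallel>x\<parallel>\<close>, \<open>B\<close> of the one for large \<open>\<parallel>x\<parallel>\<close>.\<close>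
  define A where "A = 2 * (1 + 2 * K)"
  define B where "B = real (Max S) powr \<alpha>"
  have A: "A > 0" using K(1) by (simp add: A_def)
  have "Max S \<in> S" using assms(1,2) by simp
  hence B: "B > 0" using assms(3) prime_gt_0_nat by (simp add: B_def)
  define C where "C = 2 powr (\<alpha> + 1) * (A + B)"
  have C: "C > 0" using A B by (simp add: C_def)
  show ?thesis
  proof (intro exI[of _ C] conjI ballI allI impI C)
    fix x t assume x: "x \<in> carrier (QS S)" and t: "(t::real) > 0"
    let ?f = "\<lambda>\<xi>. QS_char S (\<ominus>\<^bsub>QS S\<^esub> (x \<otimes>\<^bsub>QS S\<^esub> \<xi>)) *
                complex_of_real (exp (- t * QS_norm S \<xi> powr \<alpha>))"
    have "heat_kernel S \<mu> \<alpha> x t \<in> \<real> \<and>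
      Re (heat_kernel S \<mu> \<alpha> x t) \<le> C * t * (t powr (1 / \<alpha>) + QS_norm S x) powr (- \<alpha> - 1)"
    proof (cases "integrable \<mu> ?f")
      case False
      hence "heat_kernel S \<mu> \<alpha> x t = 0"
        unfolding heat_kernel_def by (rule not_integrable_integral_eq)
      thus ?thesis using C t by simp
    next
      case True
      interpret heat_integrand S \<mu> \<alpha> t x
        by unfold_locales (use assms x t True in auto)
      have "Re (heat_kernel S \<mu> \<alpha> x t) \<le> C * t * (t powr (1 / \<alpha>) + QS_norm S x) powr (- \<alpha> - 1)"
        unfolding C_def
      proof (rule min_bound_combined[OF t assms(5) QS_norm_nonneg A B])
        show "Re (heat_kernel S \<mu> \<alpha> x t) \<le> A * t powr (- 1 / \<alpha>)"
          using complex_Re_le_cmod[of "heat_kernel S \<mu> \<alpha> x t"] norm_heat_kernel_le integral_weight_le[OF K]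
          unfolding A_def by linarith
        show "Re (heat_kernel S \<mu> \<alpha> x t) \<le> B * t * QS_norm S x powr (- \<alpha> - 1)" if "QS_norm S x > 0"
          using heat_kernel_off_diagonal that QS_norm_zero unfolding B_def by force
      qed
      thus ?thesis using heat_kernel_real by blast
    qed
    thus "heat_kernel S \<mu> \<alpha> x t \<in> \<real>"
      "Re (heat_kernel S \<mu> \<alpha> x t) \<le> C * t * (t powr (1 / \<alpha>) + QS_norm S x) powr (- \<alpha> - 1)"
      by blast+
  qed
qed

end
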